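(* Let $\lambda_0\in(0,\pi)$, $d\in(0,1/2)$, $c_\gamma\in(0,\infty)$, $\phi=(\frac12-d)\pi$, and let $\{X_n\}_{n\in\mathbb{Z}}$ be a real second-order stationary series whose autocovariance function satisfies $$\gamma_X(h)=\big(c_\gamma\cos(\lambda_0h+\phi)+R_\gamma(h)\big)h^{2d-1},\qquad h\ge1,$$ where $$R_\gamma(h)=L_{1,\gamma}(h)\cos(\lambda_0h)h^{-2\varepsilon}+\xi L_{2,\gamma}(h)\sin(\lambda_0h)h^{-2\varepsilon},$$ with $\varepsilon\in(0,d)$, $\xi\in\{1,-1\}$, and $L_{1,\gamma},L_{2,\gamma}:(0,\infty)\to(0,\infty)$ quasi-monotone slowly varying functions at $+\infty$ such that $L_{1,\gamma}(x)\to b_1\in(0,\infty)$ and $\xi L_{2,\gamma}(x)\to b_2\in\mathbb{R}$ as $x\to+\infty$, where either $b_2=0$ (with $b_1$ arbitrary), or $\frac{b_1}{b_2}\in(-\tan(\pi(d-\varepsilon)),\tan(\pi(d-\varepsilon)))$. Then $X$ has a spectral density $f_X$ of the form $$f_X(\lambda)=\begin{cases}(c_f^-+R_f^-(\lambda_0-\lambda))(\lambda_0-\lambda)^{-2d},&0<\lambda<\lambda_0,\\(c_f^++R_f^+(\lambda-\lambda_0))(\lambda-\lambda_0)^{-2d},&\lambda_0<\lambda<\pi,\end{cases}$$ with $R_f^\pm(x)\to0$ as $x\to0^+$ and $$c_f^-=0,\qquad c_f^+=\frac{c_\gamma}{2\pi}\Gamma(2d)\sin(2\pi d).$$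
   Context: The spectral density convention is $\gamma_X(h)=\int_{-\pi}^{\pi}e^{ih\lambda}f_X(\lambda)\,d\lambda$, with $f_X(\lambda)=\frac{1}{2\pi}\sum_{h=-\infty}^\infty e^{-ih\lambda}\gamma_X(h)$. A slowly varying function $L$ at infinity with values in $(0,\infty)$ is called quasi-monotone if (i) it is of bounded variation on every compact subinterval of $[0,\infty)$, and (ii) for some $\delta>0$, $\int_0^xu^\delta|dL(u)|=O(x^\delta L(x))$ as $x\to\infty$. *)

theory Defs
  imports "HOL-Probability.Probability" "HOL-Library.Landau_Symbols"
begin

subsection \<open>Second-order stationary series and spectral densities\<close>

definition covariance :: "'a measure \<Rightarrow> ('a \<Rightarrow> real) \<Rightarrow> ('a \<Rightarrow> real) \<Rightarrow> real" where
  "covariance M Y Z =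
     (LINT \<omega>|M. (Y \<omega> - (LINT \<omega>'|M. Y \<omega>')) * (Z \<omega> - (LINT \<omega>'|M. Z \<omega>')))"

definition second_order_stationary :: "'a measure \<Rightarrow> (int \<Rightarrow> 'a \<Rightarrow> real) \<Rightarrow> bool" where
  "second_order_stationary M X \<longleftrightarrow>
     prob_space M \<and>
     (\<forall>n. X n \<in> borel_measurable M \<and> integrable M (\<lambda>\<omega>. (X n \<omega>)\<^sup>2)) \<and>
     (\<forall>n. (LINT \<omega>|M. X n \<omega>) = (LINT \<omega>|M. X 0 \<omega>)) \<and>
     (\<forall>n h. covariance M (X (n + h)) (X n) = covariance M (X h) (X 0))"

definition autocovariance :: "'a measure \<Rightarrow> (int \<Rightarrow> 'a \<Rightarrow> real) \<Rightarrow> int \<Rightarrow> real" where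
  "autocovariance M X h = covariance M (X h) (X 0)"

definition spectral_density :: "(int \<Rightarrow> real) \<Rightarrow> (real \<Rightarrow> real) \<Rightarrow> bool" where
  "spectral_density \<gamma> f \<longleftrightarrow>
     (\<forall>x\<in>{- pi..pi}. 0 \<le> f x) \<and>
     set_integrable lborel {- pi..pi} f \<and>
     (\<forall>h. complex_of_real (\<gamma> h) =
        (LINT x:{- pi..pi}|lborel. cis (of_int h * x) * complex_of_real (f x)))"

text \<open>
  The two-sided Fourier series at \<open>x\<close>, in general only conditionally convergent, is
  understood as the limit of its symmetric partial sums.
\<close>

definition spectral_series_sums :: "(int \<Rightarrow> real) \<Rightarrow> real \<Rightarrow> real \<Rightarrow> bool" where
  "spectral_series_sums \<gamma> x s \<longleftrightarrow>
     (\<lambda>N. 1 / (2 * complex_of_real pi) *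
        (\<Sum>h = - int N..int N. cis (- (of_int h * x)) * complex_of_real (\<gamma> h)))
     \<longlonglongrightarrow> complex_of_real s"

subsection \<open>Bounded variation and quasi-monotone slowly varying functions\<close>

definition variation_sums :: "(real \<Rightarrow> real) \<Rightarrow> real \<Rightarrow> real \<Rightarrow> real set" where
  "variation_sums L a b =
     {(\<Sum>i<n. \<bar>L (t (Suc i)) - L (t i)\<bar>) | (n :: nat) t.
        t 0 = a \<and> t n = b \<and> (\<forall>i<n. t i \<le> t (Suc i))}"

definition bounded_variation_on_Icc :: "(real \<Rightarrow> real) \<Rightarrow> real \<Rightarrow> real \<Rightarrow> bool" where
  "bounded_variation_on_Icc L a b \<longleftrightarrow> bdd_above (variation_sums L a b)"

definition total_variation :: "(real \<Rightarrow> real) \<Rightarrow> real \<Rightarrow> real \<Rightarrow> real" where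
  "total_variation L a b = Sup (variation_sums L a b)"

text \<open>
  The Stieltjes integral of \<open>g\<close> with respect to \<open>F\<close> over \<open>[a, b]\<close>, as in
  \<^const>\<open>has_integral\<close>, with the length of an interval replaced by the increment of \<open>F\<close>.
  For continuous \<open>g\<close> and nondecreasing \<open>F\<close> it always exists and is the
  Riemann--Stieltjes integral.
\<close>

definition has_Stieltjes_integral ::
  "(real \<Rightarrow> real) \<Rightarrow> (real \<Rightarrow> real) \<Rightarrow> real \<Rightarrow> real \<Rightarrow> real \<Rightarrow> bool" where
  "has_Stieltjes_integral g F a b I \<longleftrightarrow>
     ((\<lambda>p. \<Sum>(u, K)\<in>p. g u * (F (Sup K) - F (Inf K))) \<longlongrightarrow> I) (division_filter {a..b})"

definition slowly_varying :: "(real \<Rightarrow> real) \<Rightarrow> bool" where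
  "slowly_varying L \<longleftrightarrow>
     (\<forall>x>0. L x > 0) \<and> (\<forall>a>0. ((\<lambda>x. L (a * x) / L x) \<longlongrightarrow> 1) at_top)"

text \<open>
  The integral of \<open>u\<^sup>\<delta>\<close> against \<open>|dL(u)|\<close> over \<open>[0, x]\<close> is the Stieltjes integral with
  respect to the variation function \<open>u \<mapsto> Var(L; [0, u])\<close>. Measurability is not required in
  \<open>slowly_varying\<close>, since it follows from bounded variation. A function on \<open>(0, \<infinity>)\<close> is
  represented by a total function; its value at \<open>0\<close> affects neither bounded variation on
  \<open>[0, b]\<close> nor the integral, because the weight \<open>u\<^sup>\<delta>\<close> vanishes at \<open>0\<close>.
\<close>

definition quasi_monotone_slowly_varying :: "(real \<Rightarrow> real) \<Rightarrow> bool" where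
  "quasi_monotone_slowly_varying L \<longleftrightarrow>
     slowly_varying L \<and>
     (\<forall>a b. 0 \<le> a \<and> a \<le> b \<longrightarrow> bounded_variation_on_Icc L a b) \<and>
     (\<exists>\<delta>>0. \<exists>I.
        (\<forall>x\<ge>0. has_Stieltjes_integral (\<lambda>u. u powr \<delta>) (total_variation L 0) 0 x (I x)) \<and>
        I \<in> O[at_top](\<lambda>x. x powr \<delta> * L x))"

end

theory Submission
  imports Defs
begin

text \<open>
  Write the autocovariance as \<open>\<gamma> k = Re (A k * exp (i k \<lambda>\<^sub>0))\<close>, where
  \<open>A k = c exp (i \<phi>) k powr (2d - 1) + (L\<^sub>1 k - i \<xi> L\<^sub>2 k) k powr (2d - 2\<epsilon> - 1)\<close>. With
  \<open>F t = (\<Sum>k. A k * exp (i k t))\<close> the spectral series at \<open>x\<close> is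
  \<open>(\<gamma> 0 + Re (F (\<lambda>\<^sub>0 + x)) + Re (F (\<lambda>\<^sub>0 - x))) / (2 \<pi>)\<close>.

  Quasi-monotonicity bounds the variation of \<open>L\<^sub>1\<close> and \<open>L\<^sub>2\<close> over dyadic blocks uniformly, so summation
  by parts bounds the partial sums of such a series with coefficients of order \<open>k powr (a - 1)\<close> by
  \<open>|1 - exp (i t)| powr - a\<close>. This gives pointwise convergence off \<open>\<plusminus> \<lambda>\<^sub>0\<close>, an integrable
  majorant, hence the Fourier coefficients by dominated convergence, and the negligibility of the
  terms with \<open>L\<^sub>1\<close> and \<open>L\<^sub>2\<close>. The sum is nonnegative because its Cesaro means are. The singularity at
  \<open>\<lambda>\<^sub>0\<close> comes from comparing \<open>k powr (a - 1)\<close> with \<open>\<Gamma>(a)\<close> times the binomial coefficients of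
  \<open>(1 - z) powr - a\<close>, and \<open>\<phi>\<close> is such that the leading term cancels to the left of \<open>\<lambda>\<^sub>0\<close>.
\<close>

subsection \<open>Series with slowly decaying coefficients of bounded variation\<close>

text \<open>One constant bounds the size of the term at \<open>m\<close> and the total variation
  from \<open>m\<close> on, the latter uniformly in \<open>n\<close>; summation by parts needs just
  these two properties of \<open>k powr (a - 1)\<close>. Index \<open>0\<close> is left free, so
  bounds on sums starting at \<open>0\<close> assume \<open>A 0 = 0\<close>.\<close>

definition power_decay :: "real \<Rightarrow> real \<Rightarrow> (nat \<Rightarrow> complex) \<Rightarrow> bool" where
  "power_decay C a A \<longleftrightarrow>
     (\<forall>m\<ge>1. norm (A m) \<le> C * real m powr (a - 1) \<and>
        (\<forall>n\<ge>m. (\<Sum>k=m..<n. norm (A (Suc k) - A k)) \<le> C * real m powr (a - 1)))"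

lemma power_decayD:
  assumes "power_decay C a A" "m \<ge> 1"
  shows "norm (A m) \<le> C * real m powr (a - 1)"
    and "n \<ge> m \<Longrightarrow> (\<Sum>k=m..<n. norm (A (Suc k) - A k)) \<le> C * real m powr (a - 1)"
  using assms by (auto simp: power_decay_def)

lemma power_decay_nonneg:
  assumes "power_decay C a A"
  shows "C \<ge> 0"
proof -
  have "norm (A 1) \<le> C * real 1 powr (a - 1)"
    using power_decayD(1)[OF assms, of 1] by simp
  then show ?thesis
    using norm_ge_zero[of "A 1"] by (simp del: norm_ge_zero)
qed

lemma power_decay_mono:
  assumes A: "power_decay C b A" and "b \<le> a"
  shows "power_decay C a A"
proof -
  have "C * real m powr (b - 1) \<le> C * real m powr (a - 1)" if "m \<ge> 1" for m
    using that assms(2) power_decay_nonneg[OF A] by (intro mult_left_mono powr_mono) auto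
  then show ?thesis
    using A unfolding power_decay_def by (meson order.trans)
qed

lemma power_decay_add:
  assumes "power_decay C a A" "power_decay D a B"
  shows "power_decay (C + D) a (\<lambda>k. A k + B k)"
  unfolding power_decay_def
proof (intro allI impI conjI)
  fix m :: nat assume m: "m \<ge> 1"
  show "norm (A m + B m) \<le> (C + D) * real m powr (a - 1)"
    using power_decayD(1)[OF assms(1) m] power_decayD(1)[OF assms(2) m]
      norm_triangle_ineq[of "A m" "B m"] by (simp add: algebra_simps)
  fix n assume n: "n \<ge> m"
  have "(\<Sum>k=m..<n. norm (A (Suc k) + B (Suc k) - (A k + B k)))
      \<le> (\<Sum>k=m..<n. norm (A (Suc k) - A k) + norm (B (Suc k) - B k))"
    by (intro sum_mono) (metis add_diff_add norm_triangle_ineq)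
  also have "\<dots> \<le> (C + D) * real m powr (a - 1)"
    using power_decayD(2)[OF assms(1) m n] power_decayD(2)[OF assms(2) m n]
    by (simp add: sum.distrib algebra_simps)
  finally show "(\<Sum>k=m..<n. norm (A (Suc k) + B (Suc k) - (A k + B k)))
      \<le> (C + D) * real m powr (a - 1)" .
qed

lemma power_decay_cmult:
  assumes "power_decay C a A"
  shows "power_decay (norm w * C) a (\<lambda>k. w * A k)"
  unfolding power_decay_def
proof (intro allI impI conjI)
  fix m :: nat assume m: "m \<ge> 1"
  show "norm (w * A m) \<le> norm w * C * real m powr (a - 1)"
    using mult_left_mono[OF power_decayD(1)[OF assms m], of "norm w"]
    by (simp add: norm_mult mult_ac)
  fix n assume n: "n \<ge> m"
  show "(\<Sum>k=m..<n. norm (w * A (Suc k) - w * A k)) \<le> norm w * C * real m powr (a - 1)"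
    using mult_left_mono[OF power_decayD(2)[OF assms m n], of "norm w"]
    by (simp add: norm_mult mult_ac sum_distrib_left flip: right_diff_distrib)
qed

text \<open>Abel summation in division-free form, hence valid at \<open>z = 1\<close> too;
  \<open>binomial_series_boundary\<close> applies it on the whole closed disc.\<close>

lemma summation_by_parts_power:
  fixes A :: "nat \<Rightarrow> 'a :: comm_ring_1"
  assumes "m \<le> n"
  shows "(1 - z) * (\<Sum>k=m..<n. A k * z ^ k) =
    A m * z ^ m - A n * z ^ n + (\<Sum>k=m..<n. (A (Suc k) - A k) * z ^ Suc k)"
  using assms
proof (induction n rule: dec_induct)
  case base
  then show ?case by simp
next
  case (step l)
  have "(1 - z) * (\<Sum>k=m..<Suc l. A k * z ^ k) =
      (1 - z) * (\<Sum>k=m..<l. A k * z ^ k) + (1 - z) * (A l * z ^ l)"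
    using step.hyps by (simp add: distrib_left)
  also have "\<dots> = A m * z ^ m - A (Suc l) * z ^ Suc l
      + ((\<Sum>k=m..<l. (A (Suc k) - A k) * z ^ Suc k) + (A (Suc l) - A l) * z ^ Suc l)"
    unfolding step.IH by (simp add: left_diff_distrib right_diff_distrib mult_ac)
  finally show ?case using step.hyps by simp
qed

text \<open>Summation by parts leaves two boundary terms and a variation sum. Each is at most
  \<open>C * real m powr (a - 1)\<close>, the one at \<open>n\<close> because the weight decreases;
  hence the factor 3.\<close>

lemma power_decay_tail:
  assumes A: "power_decay C a A" and a: "a < 1" and m: "1 \<le> m" "m \<le> n"
    and z: "norm z = 1" "z \<noteq> 1"
  shows "norm (\<Sum>k=m..<n. A k * z ^ k) \<le> 3 * C * real m powr (a - 1) / norm (1 - z)"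
proof -
  have C: "C \<ge> 0" using power_decay_nonneg[OF A] .
  have "norm (A n) \<le> C * real n powr (a - 1)"
    using power_decayD(1)[OF A, of n] m by simp
  also have "\<dots> \<le> C * real m powr (a - 1)"
    using m a C by (intro mult_left_mono powr_mono2') auto
  finally have An: "norm (A n) \<le> C * real m powr (a - 1)" .
  have "norm (\<Sum>k=m..<n. (A (Suc k) - A k) * z ^ Suc k)
      \<le> (\<Sum>k=m..<n. norm (A (Suc k) - A k))"
    by (rule sum_norm_le) (simp add: norm_mult norm_power z)
  also have "\<dots> \<le> C * real m powr (a - 1)"
    by (rule power_decayD(2)[OF A m])
  finally have var: "norm (\<Sum>k=m..<n. (A (Suc k) - A k) * z ^ Suc k) \<le> C * real m powr (a - 1)" .
  have "norm (1 - z) * norm (\<Sum>k=m..<n. A k * z ^ k) =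
    norm (A m * z ^ m - A n * z ^ n + (\<Sum>k=m..<n. (A (Suc k) - A k) * z ^ Suc k))"
    by (simp only: summation_by_parts_power[OF m(2)] flip: norm_mult)
  also have "\<dots> \<le> norm (A m * z ^ m) + norm (A n * z ^ n)
      + norm (\<Sum>k=m..<n. (A (Suc k) - A k) * z ^ Suc k)"
    by (rule order.trans[OF norm_triangle_ineq add_right_mono[OF norm_triangle_ineq4]])
  also have "\<dots> \<le> 3 * C * real m powr (a - 1)"
    using An var power_decayD(1)[OF A m(1)] by (simp add: norm_mult norm_power z)
  finally show ?thesis
    using z by (simp add: field_simps)
qed

lemma power_decay_summable:
  assumes A: "power_decay C a A" and a: "a < 1" and z: "norm z = 1" "z \<noteq> 1"
  shows "summable (\<lambda>k. A k * z ^ k)"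
  unfolding summable_Cauchy
proof (intro allI impI)
  fix e :: real assume e: "e > 0"
  have "((\<lambda>m. real m powr (a - 1)) \<longlongrightarrow> 0) sequentially"
    by (rule tendsto_neg_powr) (use a filterlim_real_sequentially in auto)
  then have "((\<lambda>m. 3 * C * real m powr (a - 1) / norm (1 - z)) \<longlongrightarrow> 3 * C * 0 / norm (1 - z)) sequentially"
    by (intro tendsto_intros) (use z in auto)
  then have "eventually (\<lambda>m. 3 * C * real m powr (a - 1) / norm (1 - z) < e) sequentially"
    using e by (intro order_tendstoD(2)) auto
  then obtain N where N: "\<And>m. m \<ge> N \<Longrightarrow> 3 * C * real m powr (a - 1) / norm (1 - z) < e"
    by (auto simp: eventually_sequentially)
  show "\<exists>N. \<forall>m\<ge>N. \<forall>n. norm (\<Sum>k=m..<n. A k * z ^ k) < e"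
  proof (intro exI[of _ "max N 1"] allI impI)
    fix m n assume m: "max N 1 \<le> m"
    show "norm (\<Sum>k=m..<n. A k * z ^ k) < e"
    proof (cases "m \<le> n")
      case True
      then show ?thesis
        using power_decay_tail[OF A a _ True z] N[of m] m by simp
    qed (use e in simp)
  qed
qed

text \<open>Comparison with the integral of \<open>x powr (a - 1)\<close> from \<open>0\<close> to
  \<open>m - 1\<close>, one increment of the primitive at a time.\<close>

lemma sum_powr_le:
  assumes "0 < a" "a < 1"
  shows "(\<Sum>k=1..<m. real k powr (a - 1)) \<le> real (m - 1) powr a / a"
proof (induction m)
  case (Suc m)
  show ?case
  proof (cases "m = 0")
    case False
    have step: "real m powr (a - 1) \<le> real m powr a / a - real (m - 1) powr a / a"
    \<comment> \<open>The primitive \<open>x powr a / a\<close> is not differentiable at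
      \<open>0\<close>, so the first increment is checked directly: it reads
      \<open>1 \<le> 1 / a\<close>.\<close>
    proof (cases "m = 1")
      case True
      then show ?thesis using assms by simp
    next
      case m: False
      have "\<exists>x. real (m - 1) < x \<and> x < real m \<and>
          real m powr a / a - real (m - 1) powr a / a = (real m - real (m - 1)) * x powr (a - 1)"
      proof (rule MVT2)
        fix x assume "real (m - 1) \<le> x" "x \<le> real m"
        then have "x > 0" using m False by simp
        then show "((\<lambda>x. x powr a / a) has_real_derivative x powr (a - 1)) (at x)"
          using assms by (auto intro!: derivative_eq_intros simp: powr_diff)
      qed (use False in simp)
      then obtain x where x: "real (m - 1) < x" "x < real m"
        "real m powr a / a - real (m - 1) powr a / a = (real m - real (m - 1)) * x powr (a - 1)"
        by blast
      moreover have "real m - real (m - 1) = 1" using False by simp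
      moreover have "real m powr (a - 1) \<le> x powr (a - 1)"
        by (rule powr_mono2') (use x assms in auto)
      ultimately show ?thesis by simp
    qed
    have "(\<Sum>k=1..<Suc m. real k powr (a - 1)) = (\<Sum>k=1..<m. real k powr (a - 1)) + real m powr (a - 1)"
      using False by simp
    also have "\<dots> \<le> real m powr a / a" using Suc step by simp
    finally show ?thesis by simp
  qed simp
qed simp

text \<open>
  Terms up to about \<open>1 / |1 - z|\<close> are estimated by their absolute values, the remaining
  ones by summation by parts.
\<close>

lemma power_decay_bound:
  assumes A: "power_decay C a A" and a: "0 < a" "a < 1" and A0: "A 0 = 0"
    and z: "norm z = 1" "z \<noteq> 1"
  shows "norm (\<Sum>k<n. A k * z ^ k) \<le> (C / a + 3 * C) * norm (1 - z) powr - a"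
proof -
  have C: "C \<ge> 0" using power_decay_nonneg[OF A] .
  define w where "w = norm (1 - z)"
  have w: "w > 0" using z by (simp add: w_def)
  \<comment> \<open>The cutoff satisfies \<open>m - 1 \<le> 1 / w\<close>, which controls the head,
    and \<open>1 / w \<le> m\<close>, which controls the tail; both then have order
    \<open>w powr - a\<close>.\<close>
  define m where "m = Suc (nat \<lfloor>1 / w\<rfloor>)"
  have m1: "real (m - 1) \<le> 1 / w" "1 / w \<le> real m" "m \<ge> 1"
  proof -
    have "0 \<le> \<lfloor>1 / w\<rfloor>" using w by simp
    then have "real (nat \<lfloor>1 / w\<rfloor>) = of_int \<lfloor>1 / w\<rfloor>" by (rule of_nat_nat)
    then show "real (m - 1) \<le> 1 / w" "1 / w \<le> real m" "m \<ge> 1"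
      unfolding m_def using of_int_floor_le[of "1 / w"] real_of_int_floor_add_one_ge[of "1 / w"]
      by linarith+
  qed
  have head: "norm (\<Sum>k=1..<l. A k * z ^ k) \<le> C / a * w powr - a" if "l \<le> m" for l
  proof -
    have "norm (\<Sum>k=1..<l. A k * z ^ k) \<le> (\<Sum>k=1..<l. C * real k powr (a - 1))"
      using power_decayD(1)[OF A]
      by (intro sum_norm_le) (auto simp: norm_mult norm_power z)
    also have "\<dots> \<le> C * (real (l - 1) powr a / a)"
      unfolding sum_distrib_left[symmetric] by (intro mult_left_mono sum_powr_le a C)
    also have "\<dots> \<le> C * ((1 / w) powr a / a)"
      using that m1 a C by (intro mult_left_mono divide_right_mono powr_mono2) auto
    finally show ?thesis
      using w by (simp add: powr_divide powr_minus field_simps)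
  qed
  have eq: "(\<Sum>k<n. A k * z ^ k) = (\<Sum>k=1..<n. A k * z ^ k)"
    by (rule sum.mono_neutral_right) (use A0 in \<open>auto simp: not_le\<close>)
  show ?thesis
  proof (cases "n \<le> m")
    case True
    have "C / a * w powr - a \<le> (C / a + 3 * C) * w powr - a"
      using C by (intro mult_right_mono) auto
    then show ?thesis using head[OF True] unfolding eq w_def by simp
  next
    case False
    have "real m powr (a - 1) \<le> (1 / w) powr (a - 1)"
      by (rule powr_mono2') (use m1 w a in auto)
    then have "real m powr (a - 1) / w \<le> (1 / w) powr (a - 1) / w"
      using w by (simp add: divide_right_mono)
    also have "\<dots> = w powr - a"
      using w by (simp add: powr_divide powr_minus powr_diff field_simps)
    finally have *: "real m powr (a - 1) / w \<le> w powr - a" .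
    have "norm (\<Sum>k=m..<n. A k * z ^ k) \<le> 3 * C * (real m powr (a - 1) / w)"
      using power_decay_tail[OF A a(2) m1(3) _ z, of n] False by (simp add: w_def)
    also have "\<dots> \<le> 3 * C * w powr - a"
      using * C by (intro mult_left_mono) auto
    finally have tail: "norm (\<Sum>k=m..<n. A k * z ^ k) \<le> 3 * C * w powr - a" .
    have "(\<Sum>k=1..<n. A k * z ^ k) = (\<Sum>k=1..<m. A k * z ^ k) + (\<Sum>k=m..<n. A k * z ^ k)"
      using m1(3) False by (simp add: sum.atLeastLessThan_concat)
    then have "norm (\<Sum>k=1..<n. A k * z ^ k) \<le> C / a * w powr - a + 3 * C * w powr - a"
      using head[of m] tail norm_triangle_ineq[of "\<Sum>k=1..<m. A k * z ^ k" "\<Sum>k=m..<n. A k * z ^ k"]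
      by simp
    then show ?thesis unfolding eq w_def by (simp add: distrib_right)
  qed
qed

lemma power_decay_suminf_bound:
  assumes A: "power_decay C a A" and a: "0 < a" "a < 1" and A0: "A 0 = 0"
    and z: "norm z = 1" "z \<noteq> 1"
  shows "norm (\<Sum>k. A k * z ^ k) \<le> (C / a + 3 * C) * norm (1 - z) powr - a"
proof (rule LIMSEQ_le_const2)
  show "(\<lambda>n. norm (\<Sum>k<n. A k * z ^ k)) \<longlonglongrightarrow> norm (\<Sum>k. A k * z ^ k)"
    by (intro tendsto_norm summable_LIMSEQ power_decay_summable[OF A a(2) z])
  show "\<exists>N. \<forall>n\<ge>N. norm (\<Sum>k<n. A k * z ^ k) \<le> (C / a + 3 * C) * norm (1 - z) powr - a"
    using power_decay_bound[OF A a A0 z] by blast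
qed

subsection \<open>Weighted quasi-monotone sequences\<close>

text \<open>Appending \<open>c\<close> to a partition of \<open>[a, b]\<close> gives a partition of
  \<open>[a, c]\<close> whose sum has the extra term \<open>\<bar>L c - L b\<bar>\<close>; then take
  the supremum.\<close>

lemma total_variation_extend:
  assumes bv: "bounded_variation_on_Icc L a c" and le: "a \<le> b" "b \<le> c"
  shows "total_variation L a b + \<bar>L c - L b\<bar> \<le> total_variation L a c"
proof -
  have "total_variation L a b \<le> total_variation L a c - \<bar>L c - L b\<bar>"
    unfolding total_variation_def[of L a b]
  proof (rule cSup_least)
    show "variation_sums L a b \<noteq> {}"
    proof -
      have "(\<Sum>i<1. \<bar>L ((if Suc i = 0 then a else b)) - L (if i = 0 then a else b)\<bar>) \<in> variation_sums L a b"
        unfolding variation_sums_def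
        by (rule CollectI, rule exI[of _ 1], rule exI[of _ "\<lambda>i. if i = 0 then a else b"])
           (use le in auto)
      then show ?thesis by blast
    qed
    fix x assume "x \<in> variation_sums L a b"
    then obtain n t where t: "x = (\<Sum>i<n. \<bar>L (t (Suc i)) - L (t i)\<bar>)" "t 0 = a" "t n = b"
      "\<forall>i<n. t i \<le> t (Suc i)"
      by (auto simp: variation_sums_def)
    define s where "s = t(Suc n := c)"
    have "(\<Sum>i<Suc n. \<bar>L (s (Suc i)) - L (s i)\<bar>) \<in> variation_sums L a c"
      unfolding variation_sums_def
      by (rule CollectI, rule exI[of _ "Suc n"], rule exI[of _ s])
         (use le t in \<open>auto simp: s_def\<close>)
    then have "(\<Sum>i<Suc n. \<bar>L (s (Suc i)) - L (s i)\<bar>) \<le> total_variation L a c"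
      unfolding total_variation_def using bv
      by (intro cSup_upper) (auto simp: bounded_variation_on_Icc_def)
    moreover have "(\<Sum>i<Suc n. \<bar>L (s (Suc i)) - L (s i)\<bar>) = x + \<bar>L c - L b\<bar>"
      using t by (auto simp: s_def intro!: sum.cong)
    ultimately show "x \<le> total_variation L a c - \<bar>L c - L b\<bar>" by simp
  qed
  then show ?thesis by simp
qed

lemma total_variation_extend_sum:
  assumes bv: "\<And>c. c \<ge> 0 \<Longrightarrow> bounded_variation_on_Icc L 0 c" and "m \<le> n"
  shows "total_variation L 0 (real m) + (\<Sum>k=m..<n. \<bar>L (real (Suc k)) - L (real k)\<bar>)
    \<le> total_variation L 0 (real n)"
  using assms(2)
proof (induction n rule: dec_induct)
  case (step l)
  have "total_variation L 0 (real l) + \<bar>L (real (Suc l)) - L (real l)\<bar>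
      \<le> total_variation L 0 (real (Suc l))"
    by (rule total_variation_extend) (auto intro: bv)
  then show ?case using step by simp
qed simp

text \<open>
  The gauge of unit balls forces every tag of a subinterval that reaches beyond \<open>r\<close> to be at
  least \<open>r - 1\<close>; the increments of \<open>V\<close> beyond \<open>r\<close> are those of \<open>max (V r) \<circ> V\<close>.
\<close>

lemma Stieltjes_powr_lower_bound:
  assumes int: "has_Stieltjes_integral (\<lambda>u. u powr \<delta>) V 0 x I"
    and mono: "mono_on {0..} V" and \<delta>: "\<delta> > 0" and r: "1 \<le> r" "r \<le> x"
  shows "(r - 1) powr \<delta> * (V x - V r) \<le> I"
proof (rule tendsto_lowerbound)
  show "((\<lambda>p. \<Sum>(u, K)\<in>p. u powr \<delta> * (V (Sup K) - V (Inf K))) \<longlongrightarrow> I) (division_filter {0..x})"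
    using int by (simp add: has_Stieltjes_integral_def)
  show "division_filter {0..x} \<noteq> bot"
    using division_filter_not_empty[of "0::real" x] by (simp add: box_real)
  have g: "gauge (\<lambda>u::real. ball u 1)" by (simp add: gauge_def)
  show "\<forall>\<^sub>F p in division_filter {0..x}. (r - 1) powr \<delta> * (V x - V r)
      \<le> (\<Sum>(u, K)\<in>p. u powr \<delta> * (V (Sup K) - V (Inf K)))"
    unfolding eventually_division_filter
  proof (intro exI[of _ "\<lambda>u. ball u 1"] conjI g allI impI)
    fix p :: "(real \<times> real set) set"
    assume p: "p tagged_division_of {0..x} \<and> (\<lambda>u. ball u 1) fine p"
    define W where "W = (\<lambda>y. max (V r) (V y))"
    have "V 0 \<le> V r" "V r \<le> V x" by (rule mono_onD[OF mono]; use r in simp)+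
    then have "V x - V r = W x - W 0" by (simp add: W_def)
    also have "\<dots> = (\<Sum>(u, K)\<in>p. W (Sup K) - W (Inf K))"
      by (rule additive_tagged_division_1[symmetric]) (use p r in auto)
    finally have "(r - 1) powr \<delta> * (V x - V r) =
        (\<Sum>(u, K)\<in>p. (r - 1) powr \<delta> * (W (Sup K) - W (Inf K)))"
      by (simp add: sum_distrib_left case_prod_unfold)
    also have "\<dots> \<le> (\<Sum>(u, K)\<in>p. u powr \<delta> * (V (Sup K) - V (Inf K)))"
    proof (rule sum_mono, clarify)
      fix u K assume uK: "(u, K) \<in> p"
      obtain a b where K: "K = {a..b}"
        using tagged_division_ofD(4)[OF conjunct1[OF p] uK] by (auto simp: box_real)
      have uin: "u \<in> K" "K \<subseteq> {0..x}"
        using tagged_division_ofD(2,3)[OF conjunct1[OF p] uK] by auto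
      then have ab: "a \<le> u" "u \<le> b" "0 \<le> a" "b \<le> x" using K by auto
      have "K \<subseteq> ball u 1" using p uK by (auto simp: fine_def)
      moreover have "b \<in> K" using K ab by simp
      ultimately have ub: "u > b - 1" by (auto simp: dist_real_def)
      have SI: "Sup K = b" "Inf K = a" using K ab by simp_all
      have Vab: "V a \<le> V b" by (rule mono_onD[OF mono]) (use ab in auto)
      show "(r - 1) powr \<delta> * (W (Sup K) - W (Inf K)) \<le> u powr \<delta> * (V (Sup K) - V (Inf K))"
        unfolding SI
      proof (cases "b \<le> r")
        case True
        have "V b \<le> V r" by (rule mono_onD[OF mono]) (use ab True in auto)
        then have "W b = W a" using Vab by (simp add: W_def)
        then show "(r - 1) powr \<delta> * (W b - W a) \<le> u powr \<delta> * (V b - V a)"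
          using Vab by simp
      next
        case False
        have "(r - 1) powr \<delta> \<le> u powr \<delta>"
          by (rule powr_mono2) (use False ub r \<delta> in auto)
        moreover have "W b - W a \<le> V b - V a" "0 \<le> W b - W a" using Vab by (auto simp: W_def)
        ultimately show "(r - 1) powr \<delta> * (W b - W a) \<le> u powr \<delta> * (V b - V a)"
          by (intro mult_mono) auto
      qed
    qed
    finally show "(r - 1) powr \<delta> * (V x - V r)
      \<le> (\<Sum>(u, K)\<in>p. u powr \<delta> * (V (Sup K) - V (Inf K)))" .
  qed
qed

text \<open>On \<open>[m, 2 * m]\<close> the weight \<open>u powr \<delta>\<close> has the order of
  \<open>m powr \<delta>\<close>. Since \<open>L\<close> is eventually bounded, the growth condition
  on the Stieltjes integral therefore bounds the variation there independently of \<open>m\<close>: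
  the powers of \<open>m\<close> cancel.\<close>

lemma quasi_monotone_dyadic_variation:
  assumes qm: "quasi_monotone_slowly_varying L" and lim: "(L \<longlongrightarrow> b) at_top"
  obtains D where "D \<ge> 0" "\<And>m::nat. m \<ge> 1 \<Longrightarrow> \<bar>L (real m)\<bar> \<le> D"
    "\<And>m::nat. m \<ge> 1 \<Longrightarrow> (\<Sum>k=m..<2*m. \<bar>L (real (Suc k)) - L (real k)\<bar>) \<le> D"
proof -
  define V where "V = total_variation L 0"
  have bv: "bounded_variation_on_Icc L 0 c" if "c \<ge> 0" for c
    using qm that by (auto simp: quasi_monotone_slowly_varying_def)
  obtain \<delta> I where \<delta>: "\<delta> > 0"
    and I: "\<And>x. x \<ge> 0 \<Longrightarrow> has_Stieltjes_integral (\<lambda>u. u powr \<delta>) V 0 x (I x)"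
    and IO: "I \<in> O[at_top](\<lambda>x. x powr \<delta> * L x)"
    using qm unfolding quasi_monotone_slowly_varying_def V_def by blast
  have mono: "mono_on {0..} V"
  proof (rule mono_onI)
    fix r s :: real assume "r \<in> {0..}" "s \<in> {0..}" "r \<le> s"
    then have "V r + \<bar>L s - L r\<bar> \<le> V s"
      unfolding V_def by (intro total_variation_extend bv) auto
    then show "V r \<le> V s" by (meson abs_ge_zero add_increasing2 order.trans order_refl le_add_same_cancel1)
  qed
  obtain C where C: "C > 0" "\<forall>\<^sub>F x in at_top. norm (I x) \<le> C * norm (x powr \<delta> * L x)"
    using landau_o.bigE[OF IO] by blast
  have "\<forall>\<^sub>F x in at_top. \<bar>L x\<bar> < \<bar>b\<bar> + 1"
    by (rule order_tendstoD(2)[OF tendsto_rabs[OF lim]]) simp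
  then have "\<forall>\<^sub>F x in at_top. \<bar>I x\<bar> \<le> C * (\<bar>b\<bar> + 1) * x powr \<delta> \<and> \<bar>L x\<bar> < \<bar>b\<bar> + 1"
    using C(2)
  proof eventually_elim
    case (elim x)
    have "norm (I x) \<le> C * (x powr \<delta> * \<bar>L x\<bar>)" using elim by (simp add: abs_mult)
    also have "\<dots> \<le> C * (x powr \<delta> * (\<bar>b\<bar> + 1))"
      using elim C(1) by (intro mult_left_mono) auto
    finally show ?case using elim by (simp add: mult_ac)
  qed
  then obtain M where M: "\<And>x. x \<ge> M \<Longrightarrow> \<bar>I x\<bar> \<le> C * (\<bar>b\<bar> + 1) * x powr \<delta>"
      "\<And>x. x \<ge> M \<Longrightarrow> \<bar>L x\<bar> < \<bar>b\<bar> + 1"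
    by (auto simp: eventually_at_top_linorder)
  define v where "v m = (\<Sum>k=m..<2*m. \<bar>L (real (Suc k)) - L (real k)\<bar>)" for m
  \<comment> \<open>\<open>M\<close> is where the asymptotic bounds set in. The \<open>2\<close>
    makes \<open>real m - 1\<close> positive, so that its power can be cancelled, and gives
    \<open>2 * m \<le> 4 * (m - 1)\<close>, the source of \<open>4 powr \<delta>\<close>.\<close>
  define N where "N = max 2 (nat \<lceil>M\<rceil>)"
  have large: "v m \<le> C * (\<bar>b\<bar> + 1) * 4 powr \<delta>" if m: "m \<ge> N" for m
  proof -
    have mM: "real m \<ge> M" "m \<ge> 2" using m real_nat_ceiling_ge[of M] unfolding N_def by linarith+
    have var: "v m \<le> V (real (2 * m)) - V (real m)"
      using total_variation_extend_sum[OF bv, of m "2 * m"] unfolding V_def v_def by auto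
    have four: "real (2 * m) powr \<delta> \<le> 4 powr \<delta> * (real m - 1) powr \<delta>"
      unfolding powr_mult[symmetric] by (rule powr_mono2) (use mM \<delta> in auto)
    have "(real m - 1) powr \<delta> * v m \<le> (real m - 1) powr \<delta> * (V (real (2 * m)) - V (real m))"
      by (rule mult_left_mono[OF var]) simp
    also have "\<dots> \<le> I (real (2 * m))"
      by (rule Stieltjes_powr_lower_bound[OF I mono \<delta>]) (use mM in auto)
    also have "\<dots> \<le> C * (\<bar>b\<bar> + 1) * real (2 * m) powr \<delta>"
      using M(1)[of "real (2 * m)"] mM by simp
    also have "\<dots> \<le> C * (\<bar>b\<bar> + 1) * (4 powr \<delta> * (real m - 1) powr \<delta>)"
      by (rule mult_left_mono[OF four]) (use C in auto)
    finally have "(real m - 1) powr \<delta> * v m \<le> (real m - 1) powr \<delta> * (C * (\<bar>b\<bar> + 1) * 4 powr \<delta>)"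
      by (simp add: mult_ac)
    then show ?thesis using mM by (simp add: mult_le_cancel_left)
  qed
  \<comment> \<open>The finitely many \<open>m < N\<close>, where no asymptotic bound is available,
    are absorbed by adding their contributions to the constant.\<close>
  define D where "D = C * (\<bar>b\<bar> + 1) * 4 powr \<delta> + (\<bar>b\<bar> + 1) + (\<Sum>m<N. v m) + (\<Sum>m<N. \<bar>L (real m)\<bar>)"
  have nn: "0 \<le> C * (\<bar>b\<bar> + 1) * 4 powr \<delta>" "0 \<le> (\<Sum>m<N. v m)" "0 \<le> (\<Sum>m<N. \<bar>L (real m)\<bar>)"
    using C(1) by (auto simp: v_def intro!: sum_nonneg)
  show thesis
  proof (rule that[of D])
    show "D \<ge> 0" using nn unfolding D_def by linarith
  next
    fix m :: nat assume "m \<ge> 1"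
    show "\<bar>L (real m)\<bar> \<le> D"
    proof (cases "m < N")
      case True
      then have "\<bar>L (real m)\<bar> \<le> (\<Sum>m<N. \<bar>L (real m)\<bar>)"
        by (intro member_le_sum) auto
      then show ?thesis using nn unfolding D_def by linarith
    next
      case False
      then have "real m \<ge> M"
        using real_nat_ceiling_ge[of M] unfolding N_def by linarith
      then show ?thesis using M(2)[of "real m"] nn unfolding D_def by linarith
    qed
    show "(\<Sum>k=m..<2*m. \<bar>L (real (Suc k)) - L (real k)\<bar>) \<le> D"
    proof (cases "m < N")
      case True
      then have "v m \<le> (\<Sum>m<N. v m)"
        by (intro member_le_sum) (auto simp: v_def intro!: sum_nonneg)
      then show ?thesis using nn unfolding v_def[symmetric] D_def by linarith
    next
      case False
      then show ?thesis using large[of m] nn unfolding v_def[symmetric] D_def by linarith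
    qed
  qed
qed

text \<open>Cut the range into blocks \<open>[m, 2 * m)\<close>, \<open>[2 * m, 4 * m)\<close> and
  so on. The weight at the left ends shrinks by the ratio \<open>2 powr (a - 1) < 1\<close>, and the
  geometric series gives the constant. The induction on \<open>n - m\<close> peels off the first
  block.\<close>

lemma dyadic_variation_weighted:
  fixes l :: "nat \<Rightarrow> real"
  assumes D: "D \<ge> 0" "\<And>m::nat. m \<ge> 1 \<Longrightarrow> (\<Sum>k=m..<2*m. \<bar>l (Suc k) - l k\<bar>) \<le> D"
    and a: "a < 1" and "1 \<le> m" "m \<le> n"
  shows "(\<Sum>k=m..<n. \<bar>l (Suc k) - l k\<bar> * real k powr (a - 1))
    \<le> D / (1 - 2 powr (a - 1)) * real m powr (a - 1)"
  using assms(4,5)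
proof (induction "n - m" arbitrary: m rule: less_induct)
  case less
  define q where "q = 2 powr (a - 1)"
  have q: "0 < q" "q < 1" using a by (auto simp: q_def powr_less_one)
  define p where "p = real m powr (a - 1)"
  have p: "p \<ge> 0" by (simp add: p_def)
  have head: "(\<Sum>k=m..<j. \<bar>l (Suc k) - l k\<bar> * real k powr (a - 1)) \<le> D * p" if "j \<le> 2 * m" for j
  proof -
    have "(\<Sum>k=m..<j. \<bar>l (Suc k) - l k\<bar> * real k powr (a - 1)) \<le> (\<Sum>k=m..<j. \<bar>l (Suc k) - l k\<bar> * p)"
      unfolding p_def using less.prems a by (intro sum_mono mult_left_mono powr_mono2') auto
    also have "\<dots> \<le> (\<Sum>k=m..<2*m. \<bar>l (Suc k) - l k\<bar> * p)"
      by (rule sum_mono2) (use that p in auto)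
    also have "\<dots> \<le> D * p"
      unfolding sum_distrib_right[symmetric] using D(2)[OF less.prems(1)] p by (intro mult_right_mono)
    finally show ?thesis .
  qed
  have Dq: "D \<le> D / (1 - q)"
    using q D(1) by (simp add: pos_le_divide_eq mult_left_le)
  show ?case
  proof (cases "n \<le> 2 * m")
    case True
    have "D * p \<le> D / (1 - q) * p" by (rule mult_right_mono[OF Dq p])
    then show ?thesis using head[OF True] unfolding p_def q_def by linarith
  next
    case False
    have "(\<Sum>k=2*m..<n. \<bar>l (Suc k) - l k\<bar> * real k powr (a - 1))
        \<le> D / (1 - q) * real (2 * m) powr (a - 1)"
      unfolding q_def by (rule less.hyps) (use less.prems False in auto)
    also have "real (2 * m) powr (a - 1) = q * p"
      by (simp add: q_def p_def powr_mult)
    finally have "(\<Sum>k=m..<2*m. \<bar>l (Suc k) - l k\<bar> * real k powr (a - 1))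
        + (\<Sum>k=2*m..<n. \<bar>l (Suc k) - l k\<bar> * real k powr (a - 1)) \<le> D * p + D / (1 - q) * (q * p)"
      using head[of "2 * m"] by linarith
    \<comment> \<open>The constant reproduces itself: \<open>Q = D / (1 - q)\<close> solves
      \<open>D + q * Q = Q\<close>.\<close>
    also have "\<dots> = D / (1 - q) * p" using q by (simp add: field_simps)
    finally show ?thesis
      using False unfolding p_def q_def by (subst (asm) sum.atLeastLessThan_concat) auto
  qed
qed

text \<open>Discrete product rule: increments of \<open>l\<close> are handled by
  \<open>dyadic_variation_weighted\<close>; next to increments of the weight, \<open>l\<close> is
  bounded by \<open>D\<close> and the monotone weight telescopes.\<close>

lemma power_decay_weighted:
  fixes l :: "nat \<Rightarrow> real"
  assumes D: "D \<ge> 0" "\<And>m::nat. m \<ge> 1 \<Longrightarrow> \<bar>l m\<bar> \<le> D"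
    "\<And>m::nat. m \<ge> 1 \<Longrightarrow> (\<Sum>k=m..<2*m. \<bar>l (Suc k) - l k\<bar>) \<le> D"
    and a: "a < 1"
  shows "power_decay (D + D / (1 - 2 powr (a - 1))) a (\<lambda>k. of_real (l k * real k powr (a - 1)))"
  unfolding power_decay_def
proof (intro allI impI conjI)
  define Q where "Q = D / (1 - 2 powr (a - 1))"
  have Q: "Q \<ge> 0" using D(1) a powr_less_one[of 2 "a - 1"] by (simp add: Q_def)
  fix m :: nat assume m: "m \<ge> 1"
  have "\<bar>l m\<bar> * real m powr (a - 1) \<le> (D + Q) * real m powr (a - 1)"
    using D(2)[OF m] Q by (intro mult_right_mono) auto
  then show "cmod (complex_of_real (l m * real m powr (a - 1)))
      \<le> (D + D / (1 - 2 powr (a - 1))) * real m powr (a - 1)"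
    by (simp add: norm_mult Q_def)
  fix n assume n: "n \<ge> m"
  define P where "P k = real k powr (a - 1)" for k
  have P: "P (Suc k) \<le> P k" if "k \<ge> m" for k
    unfolding P_def by (rule powr_mono2') (use that m a in auto)
  have "(\<Sum>k=m..<n. \<bar>l (Suc k) * P (Suc k) - l k * P k\<bar>)
      \<le> (\<Sum>k=m..<n. \<bar>l (Suc k) - l k\<bar> * P k + D * (P k - P (Suc k)))"
  proof (rule sum_mono)
    fix k assume k: "k \<in> {m..<n}"
    have "\<bar>l (Suc k) * P (Suc k) - l k * P k\<bar>
        = \<bar>(l (Suc k) - l k) * P k - l (Suc k) * (P k - P (Suc k))\<bar>"
      by (simp add: algebra_simps)
    also have "\<dots> \<le> \<bar>(l (Suc k) - l k) * P k\<bar> + \<bar>l (Suc k) * (P k - P (Suc k))\<bar>"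
      by (rule abs_triangle_ineq4)
    also have "\<bar>(l (Suc k) - l k) * P k\<bar> = \<bar>l (Suc k) - l k\<bar> * P k"
      by (simp add: abs_mult P_def)
    also have "\<bar>l (Suc k) * (P k - P (Suc k))\<bar> \<le> D * (P k - P (Suc k))"
      using P[of k] k D(2)[of "Suc k"] by (auto simp: abs_mult intro!: mult_right_mono)
    finally show "\<bar>l (Suc k) * P (Suc k) - l k * P k\<bar>
        \<le> \<bar>l (Suc k) - l k\<bar> * P k + D * (P k - P (Suc k))" by simp
  qed
  also have "\<dots> = (\<Sum>k=m..<n. \<bar>l (Suc k) - l k\<bar> * P k) + D * (\<Sum>k=m..<n. P k - P (Suc k))"
    by (simp add: sum.distrib sum_distrib_left)
  also have "(\<Sum>k=m..<n. P k - P (Suc k)) = P m - P n"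
    using sum_Suc_diff'[OF n, of "\<lambda>k. - P k"] by simp
  also have "(\<Sum>k=m..<n. \<bar>l (Suc k) - l k\<bar> * P k) + D * (P m - P n) \<le> Q * P m + D * P m"
    using dyadic_variation_weighted[OF D(1,3) a m n] D(1)
    unfolding Q_def P_def by (intro add_mono mult_left_mono) auto
  finally show "(\<Sum>k=m..<n. cmod (complex_of_real (l (Suc k) * real (Suc k) powr (a - 1))
        - complex_of_real (l k * real k powr (a - 1))))
      \<le> (D + D / (1 - 2 powr (a - 1))) * real m powr (a - 1)"
    unfolding P_def Q_def of_real_diff[symmetric] norm_of_real by (simp add: algebra_simps)
qed

lemma power_decay_powr:
  assumes "a < 1"
  shows "\<exists>C. power_decay C a (\<lambda>k. of_real (real k powr (a - 1)))"
  using power_decay_weighted[of 1 "\<lambda>_. 1" a] assms by auto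

lemma power_decay_quasi_monotone:
  assumes "quasi_monotone_slowly_varying L" "(L \<longlongrightarrow> b) at_top" "a < 1"
  shows "\<exists>C. power_decay C a (\<lambda>k. of_real (L (real k) * real k powr (a - 1)))"
proof -
  obtain D where "D \<ge> 0" "\<And>m::nat. m \<ge> 1 \<Longrightarrow> \<bar>L (real m)\<bar> \<le> D"
    "\<And>m::nat. m \<ge> 1 \<Longrightarrow> (\<Sum>k=m..<2*m. \<bar>L (real (Suc k)) - L (real k)\<bar>) \<le> D"
    using quasi_monotone_dyadic_variation[OF assms(1,2)] by blast
  then show ?thesis
    using power_decay_weighted[of D "\<lambda>k. L (real k)" a] assms(3) by blast
qed

subsection \<open>The series with coefficients \<open>k powr (a - 1)\<close>\<close>

text \<open>The quantity estimated is \<open>Gamma (n + a) / Gamma (n + 1)\<close>, and both bounds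
  come from log-convexity of the Gamma function. They are neighbouring terms of one decreasing
  sequence, so that the approximation error telescopes in
  \<open>powr_series_near_binomial\<close>.\<close>

lemma Gautschi_bounds:
  fixes a :: real
  assumes a: "0 < a" "a < 1" and n: "n \<ge> 1"
  shows "Gamma a * (pochhammer a n / fact n) \<le> real n powr (a - 1)"
    and "real (Suc n) powr (a - 1) \<le> Gamma a * (pochhammer a n / fact n)"
proof -
  define h :: "real \<Rightarrow> real" where "h = ln \<circ> Gamma"
  define g where "g = Gamma a * (pochhammer a n / fact n)"
  have conv: "h ((1 - t) * x + t * y) \<le> (1 - t) * h x + t * h y"
    if "0 \<le> t" "t \<le> 1" "x > 0" "y > 0" for t x y
    unfolding h_def using convex_onD[OF log_convex_Gamma_real, of t x y] that by simp
  have step: "h (x + 1) = ln x + h x" if "x > 0" for x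
  proof -
    have "x \<notin> \<int>\<^sub>\<le>\<^sub>0" using that by (auto elim!: nonpos_Ints_cases')
    moreover have "Gamma x \<noteq> 0" using Gamma_real_pos[OF that] by simp
    ultimately show ?thesis
      using that by (simp add: h_def Gamma_plus1 ln_mult)
  qed
  have "a \<notin> \<int>\<^sub>\<le>\<^sub>0" using a by (auto elim!: nonpos_Ints_cases')
  then have g: "g = Gamma (real n + a) / Gamma (real n + 1)"
    using pochhammer_Gamma[of a n] Gamma_real_pos[OF a(1)] Gamma_fact[of n, where ?'a = real]
    by (simp add: g_def add_ac)
  have pos: "Gamma (real n + a) > 0" "Gamma (real n + 1) > 0"
    using a by (auto intro!: Gamma_real_pos)
  then have Gnz: "Gamma (real n + a) \<noteq> 0" "Gamma (real n + 1) \<noteq> 0" by linarith+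
  from pos have gpos: "g > 0" by (simp add: g)
  have lng: "ln g = h (real n + a) - h (real n + 1)"
    unfolding g h_def using Gnz by (simp add: ln_div)
  \<comment> \<open>Convexity with \<open>n + a\<close> between \<open>n\<close> and
    \<open>n + 1\<close>; for the lower bound below, \<open>n + 1\<close> lies between
    \<open>n + a\<close> and \<open>n + a + 1\<close>.\<close>
  have "h ((1 - a) * real n + a * (real n + 1)) \<le> (1 - a) * h (real n) + a * h (real n + 1)"
    by (rule conv) (use a n in auto)
  also have "(1 - a) * real n + a * (real n + 1) = real n + a" by (simp add: algebra_simps)
  also have "h (real n) = h (real n + 1) - ln (real n)" using step[of "real n"] n by simp
  finally have "ln g \<le> (a - 1) * ln (real n)" unfolding lng by (simp add: algebra_simps)
  then show "Gamma a * (pochhammer a n / fact n) \<le> real n powr (a - 1)"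
    unfolding g_def[symmetric] using n gpos
    by (metis exp_le_cancel_iff exp_ln powr_def of_nat_0_eq_iff not_one_le_zero)
  have "h ((1 - (1 - a)) * (real n + a) + (1 - a) * (real n + a + 1))
      \<le> (1 - (1 - a)) * h (real n + a) + (1 - a) * h (real n + a + 1)"
    by (rule conv) (use a n in auto)
  also have "(1 - (1 - a)) * (real n + a) + (1 - a) * (real n + a + 1) = real n + 1"
    by (simp add: algebra_simps)
  also have "h (real n + a + 1) = ln (real n + a) + h (real n + a)"
    by (rule step) (use a n in auto)
  finally have "(a - 1) * ln (real n + a) \<le> ln g" unfolding lng by (simp add: algebra_simps)
  moreover have "(a - 1) * ln (real (Suc n)) \<le> (a - 1) * ln (real n + a)"
    by (rule mult_left_mono_neg) (use a n in auto)
  ultimately have "(a - 1) * ln (real (Suc n)) \<le> ln g" by linarith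
  then have "exp ((a - 1) * ln (real (Suc n))) \<le> g"
    using gpos by (metis exp_le_cancel_iff exp_ln)
  then show "real (Suc n) powr (a - 1) \<le> Gamma a * (pochhammer a n / fact n)"
    unfolding g_def[symmetric] by (simp add: powr_def)
qed

lemma pochhammer_fact_tendsto_0:
  fixes a :: real
  assumes a: "0 < a" "a < 1"
  shows "(\<lambda>n. pochhammer a n / fact n) \<longlonglongrightarrow> 0"
proof (rule tendsto_sandwich[of "\<lambda>_. 0" _ _ "\<lambda>n. real n powr (a - 1) / Gamma a"])
  have "Gamma a > 0" using a by (intro Gamma_real_pos)
  then show "\<forall>\<^sub>F n in sequentially. pochhammer a n / fact n \<le> real n powr (a - 1) / Gamma a"
    using Gautschi_bounds(1)[OF a]
    by (intro eventually_sequentiallyI[of 1]) (simp add: field_simps)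
  have "(\<lambda>n. real n powr (a - 1)) \<longlonglongrightarrow> 0"
    by (rule tendsto_neg_powr) (use a filterlim_real_sequentially in auto)
  then show "(\<lambda>n. real n powr (a - 1) / Gamma a) \<longlonglongrightarrow> 0"
    using tendsto_divide_zero by blast
qed (use a in \<open>auto intro!: always_eventually pochhammer_nonneg divide_nonneg_nonneg\<close>)

text \<open>
  After multiplication by \<open>1 - z\<close> the series converges absolutely, hence to a continuous
  function, on the whole closed disc.
\<close>

lemma binomial_series_boundary:
  fixes a :: real and z :: complex
  assumes a: "0 < a" "a < 1" and z: "norm z = 1" "z \<noteq> 1"
  shows "(\<lambda>n. of_real (pochhammer a n / fact n) * z ^ n) sums ((1 - z) powr of_real (- a))"
proof -
  define c where "c n = pochhammer a n / fact n" for n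
  have c0: "c \<longlonglongrightarrow> 0" unfolding c_def by (rule pochhammer_fact_tendsto_0[OF a])
  have cdec: "c (Suc n) \<le> c n" for n
  proof -
    have "c (Suc n) = c n * ((a + real n) / (1 + real n))"
      by (simp add: c_def pochhammer_Suc field_simps)
    also have "\<dots> \<le> c n"
      using a by (intro mult_left_le) (auto simp: c_def intro!: divide_nonneg_nonneg pochhammer_nonneg)
    finally show ?thesis .
  qed
  \<comment> \<open>\<open>G w\<close> is to be the limit of \<open>1 - w\<close> times the partial
    sums. As \<open>c\<close> decreases to \<open>0\<close>, its increments are absolutely summable;
    the leading \<open>1\<close> is \<open>c 0\<close>.\<close>
  define G where "G = (\<lambda>w :: complex. 1 + (\<Sum>n. of_real (c (Suc n) - c n) * w ^ Suc n))"
  have norm_le: "norm (of_real (c (Suc n) - c n) * w ^ Suc n) \<le> c n - c (Suc n)"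
    if "w \<in> cball 0 1" for w :: complex and n
  proof -
    have "norm (w ^ Suc n) \<le> 1" unfolding norm_power using that by (intro power_le_one) auto
    then have "\<bar>c (Suc n) - c n\<bar> * norm (w ^ Suc n) \<le> \<bar>c (Suc n) - c n\<bar> * 1"
      by (intro mult_left_mono) auto
    moreover have "\<bar>c (Suc n) - c n\<bar> = c n - c (Suc n)" using cdec[of n] by simp
    ultimately show ?thesis by (simp only: norm_mult norm_of_real mult_1_right)
  qed
  have sm: "summable (\<lambda>n. c n - c (Suc n))"
    by (rule telescope_summable'[OF c0])
  have ul: "uniform_limit (cball 0 1) (\<lambda>N w. \<Sum>n<N. of_real (c (Suc n) - c n) * w ^ Suc n)
      (\<lambda>w :: complex. \<Sum>n. of_real (c (Suc n) - c n) * w ^ Suc n) sequentially"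
    by (rule Weierstrass_m_test[OF norm_le sm])
  have contG: "continuous_on (cball 0 1) G"
    unfolding G_def
    by (intro continuous_intros uniform_limit_theorem[OF _ ul] always_eventually allI) auto
  have partial: "(\<lambda>n. (1 - w) * (\<Sum>k<n. of_real (c k) * w ^ k)) \<longlonglongrightarrow> G w"
    if w: "w \<in> cball 0 1" for w :: complex
  proof -
    have "(\<lambda>n. of_real (c n) * w ^ n) \<longlonglongrightarrow> 0"
    proof (rule Lim_null_comparison[OF _ c0], intro always_eventually allI)
      fix n
      have "norm (w ^ n) \<le> 1" unfolding norm_power using w by (intro power_le_one) auto
      moreover have "c n \<ge> 0"
        using a by (auto simp: c_def intro!: divide_nonneg_nonneg pochhammer_nonneg)
      ultimately show "norm (of_real (c n) * w ^ n) \<le> c n"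
        by (simp add: norm_mult mult_left_le)
    qed
    moreover have "(\<lambda>n. \<Sum>k<n. of_real (c (Suc k) - c k) * w ^ Suc k)
        \<longlonglongrightarrow> (\<Sum>k. of_real (c (Suc k) - c k) * w ^ Suc k)"
      using tendsto_uniform_limitI[OF ul w] .
    ultimately have "(\<lambda>n. 1 - of_real (c n) * w ^ n + (\<Sum>k<n. of_real (c (Suc k) - c k) * w ^ Suc k))
        \<longlonglongrightarrow> 1 - 0 + (\<Sum>k. of_real (c (Suc k) - c k) * w ^ Suc k)"
      by (intro tendsto_intros)
    moreover have "1 - of_real (c n) * w ^ n + (\<Sum>k<n. of_real (c (Suc k) - c k) * w ^ Suc k)
        = (1 - w) * (\<Sum>k<n. of_real (c k) * w ^ k)" for n
      using summation_by_parts_power[of 0 n w "\<lambda>k. complex_of_real (c k)"]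
      by (simp add: atLeast0LessThan c_def)
    ultimately show ?thesis by (simp add: G_def)
  qed
  \<comment> \<open>\<open>H\<close> is the expected value of \<open>G\<close>: the binomial theorem
    gives \<open>G = H\<close> in the open disc, and continuity along the radius towards
    \<open>z\<close> carries the equality to the boundary.\<close>
  define H where "H = (\<lambda>w :: complex. (1 - w) * (1 - w) powr of_real (- a))"
  have inner: "G w = H w" if w: "norm w < 1" for w
  proof (rule LIMSEQ_unique[OF partial])
    have "(\<lambda>n. ((- of_real a) gchoose n) * (- w) ^ n) sums (1 + (- w)) powr (- of_real a)"
      by (rule gen_binomial_complex) (use w in simp)
    moreover have "((- of_real a) gchoose n) * (- w) ^ n = of_real (c n) * w ^ n" for n
    proof -
      have "(- 1 :: complex) ^ n * (- w) ^ n = w ^ n"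
        by (simp flip: power_mult_distrib)
      then show ?thesis
        by (simp add: gbinomial_pochhammer c_def pochhammer_of_real)
    qed
    ultimately have "(\<lambda>n. of_real (c n) * w ^ n) sums (1 - w) powr of_real (- a)"
      by simp
    then show "(\<lambda>n. (1 - w) * (\<Sum>k<n. of_real (c k) * w ^ k)) \<longlonglongrightarrow> H w"
      unfolding H_def sums_def by (intro tendsto_intros)
  qed (use w in simp)
  \<comment> \<open>On the unit circle only the point \<open>1\<close> has real part
    \<open>1\<close>. So \<open>1 - z\<close> has positive real part and avoids the branch cut of
    the complex power.\<close>
  have "Re z < 1"
  proof (rule ccontr)
    assume "\<not> Re z < 1"
    then have "Re z = 1" using complex_Re_le_cmod[of z] z by simp
    then show False using z by (auto simp: cmod_def complex_eq_iff)
  qed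
  then have nz: "1 - z \<notin> \<real>\<^sub>\<le>\<^sub>0"
    by (auto simp: complex_nonpos_Reals_iff)
  define y where "y n = of_real (real n / real (Suc n)) * z" for n
  have "(\<lambda>n. complex_of_real (real n / real (Suc n))) \<longlonglongrightarrow> complex_of_real 1"
    by (intro tendsto_of_real LIMSEQ_n_over_Suc_n)
  then have ylim: "y \<longlonglongrightarrow> z"
    unfolding y_def using tendsto_mult_right[of _ 1 sequentially z] by fastforce
  have ynorm: "norm (y n) < 1" for n
    by (simp only: y_def norm_mult norm_of_real z) simp
  have "(\<lambda>n. G (y n)) \<longlonglongrightarrow> G z"
  proof (rule continuous_on_tendsto_compose[OF contG ylim])
    show "z \<in> cball 0 1" using z by simp
    show "\<forall>\<^sub>F n in sequentially. y n \<in> cball 0 1"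
      using ynorm by (intro always_eventually) (auto simp: less_imp_le)
  qed
  moreover have "(\<lambda>n. H (y n)) \<longlonglongrightarrow> H z"
    unfolding H_def by (intro tendsto_intros ylim disjI1 nz)
  ultimately have "G z = H z"
    using inner[OF ynorm] by (simp add: LIMSEQ_unique)
  then have "(\<lambda>n. (1 - z) * (\<Sum>k<n. of_real (c k) * z ^ k) / (1 - z)) \<longlonglongrightarrow> H z / (1 - z)"
    using partial[of z] z by (intro tendsto_divide) auto
  then show ?thesis
    using z by (simp add: sums_def H_def c_def)
qed

text \<open>The coefficients differ by \<open>e k\<close>, and for \<open>k \<ge> 1\<close> the
  bounds of \<open>Gautschi_bounds\<close> put \<open>e k\<close> between \<open>0\<close> and
  \<open>k powr (a - 1) - (k + 1) powr (a - 1)\<close>, which telescopes to at most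
  \<open>1\<close>. The summand \<open>Gamma a\<close> is the term \<open>e 0\<close>, because
  \<open>0 powr (a - 1) = 0\<close>.\<close>

lemma powr_series_near_binomial:
  fixes a :: real and z :: complex
  assumes a: "0 < a" "a < 1" and z: "norm z = 1" "z \<noteq> 1"
  shows "norm ((\<Sum>k. of_real (real k powr (a - 1)) * z ^ k) - of_real (Gamma a) * (1 - z) powr of_real (- a))
    \<le> Gamma a + 1"
proof -
  define c where "c n = pochhammer a n / fact n" for n
  define e where "e k = real k powr (a - 1) - Gamma a * c k" for k
  have Gpos: "Gamma a > 0" using a by (intro Gamma_real_pos)
  obtain C where "power_decay C a (\<lambda>k. of_real (real k powr (a - 1)))"
    using power_decay_powr[OF a(2)] by blast
  then have "summable (\<lambda>k. of_real (real k powr (a - 1)) * z ^ k)"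
    using power_decay_summable a z by blast
  from summable_sums[OF this]
  have "(\<lambda>k. of_real (real k powr (a - 1)) * z ^ k - of_real (Gamma a) * (of_real (c k) * z ^ k)) sums
    ((\<Sum>k. of_real (real k powr (a - 1)) * z ^ k) - of_real (Gamma a) * (1 - z) powr of_real (- a))"
    unfolding c_def by (intro sums_diff sums_mult binomial_series_boundary a z)
  then have "(\<lambda>n. norm (\<Sum>k<n. of_real (e k) * z ^ k)) \<longlonglongrightarrow>
    norm ((\<Sum>k. of_real (real k powr (a - 1)) * z ^ k) - of_real (Gamma a) * (1 - z) powr of_real (- a))"
    unfolding sums_def by (intro tendsto_norm) (simp add: e_def algebra_simps)
  then show ?thesis
  proof (rule LIMSEQ_le_const2, intro exI[of _ 1] allI impI)
    fix n :: nat assume n: "n \<ge> 1"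
    have "norm (\<Sum>k<n. of_real (e k) * z ^ k) \<le> (\<Sum>k<n. \<bar>e k\<bar>)"
      by (rule sum_norm_le) (simp add: norm_mult norm_power z)
    also have "\<dots> = \<bar>e 0\<bar> + (\<Sum>k=1..<n. \<bar>e k\<bar>)"
      using n by (simp add: lessThan_atLeast0 sum.atLeast_Suc_lessThan)
    also have "(\<Sum>k=1..<n. \<bar>e k\<bar>) \<le> (\<Sum>k=1..<n. real k powr (a - 1) - real (Suc k) powr (a - 1))"
      using Gautschi_bounds[OF a] by (intro sum_mono) (force simp: e_def c_def)
    also have "\<dots> = 1 - real n powr (a - 1)"
      using sum_Suc_diff'[OF n, of "\<lambda>k. - (real k powr (a - 1))"] by simp
    also have "\<dots> \<le> 1" by simp
    also have "\<bar>e 0\<bar> = Gamma a" using Gpos by (simp add: e_def c_def)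
    finally show "norm (\<Sum>k<n. of_real (e k) * z ^ k) \<le> Gamma a + 1" by simp
  qed
qed

section \<open>Behaviour of the series on the unit circle as the angle tends to zero\<close>

lemma norm_one_minus_cis: "norm (1 - cis t) = 2 * \<bar>sin (t / 2)\<bar>"
proof -
  have "(norm (1 - cis t))\<^sup>2 = (1 - cos t)\<^sup>2 + (sin t)\<^sup>2"
    by (simp add: cmod_power2)
  also have "\<dots> = 2 - 2 * cos t"
    using sin_cos_squared_add[of t] by (simp add: power2_eq_square algebra_simps)
  also have "\<dots> = (2 * \<bar>sin (t / 2)\<bar>)\<^sup>2"
    using cos_double_sin[of "t / 2"] by (simp add: power_mult_distrib)
  finally show ?thesis by (rule power2_eq_imp_eq) simp_all
qed

text \<open>In the polar form \<open>1 - cis t = 2 * sin (t / 2) * cis ((t - pi) / 2)\<close> the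
  angle lies in \<open>(- pi / 2, pi / 2)\<close>, so it is the principal argument and the power
  multiplies it by \<open>- a\<close>.\<close>

lemma one_minus_cis_powr:
  assumes t: "0 < t" "t < 2 * pi"
  shows "(1 - cis t) powr of_real (- a) = of_real ((2 * sin (t / 2)) powr - a) * cis (a * (pi - t) / 2)"
proof -
  have s: "sin (t / 2) > 0" using t by (intro sin_gt_zero) auto
  have "1 - cis t = of_real (2 * sin (t / 2)) * cis ((t - pi) / 2)"
  proof (rule complex_eqI)
    have "cos ((t - pi) / 2) = sin (t / 2)" "sin ((t - pi) / 2) = - cos (t / 2)"
      by (simp_all add: diff_divide_distrib cos_diff sin_diff)
    then show "Re (1 - cis t) = Re (of_real (2 * sin (t / 2)) * cis ((t - pi) / 2))"
      "Im (1 - cis t) = Im (of_real (2 * sin (t / 2)) * cis ((t - pi) / 2))"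
      using cos_double_sin[of "t / 2"] sin_double[of "t / 2"] by (simp_all add: power2_eq_square)
  qed
  moreover have "complex_of_real (2 * sin (t / 2)) = exp (of_real (ln (2 * sin (t / 2))))"
    using s by (simp only: exp_of_real exp_ln_iff) simp
  ultimately have eq: "1 - cis t = exp (of_real (ln (2 * sin (t / 2))) + \<i> * of_real ((t - pi) / 2))"
    by (simp only: exp_add cis_conv_exp)
  have "Ln (1 - cis t) = of_real (ln (2 * sin (t / 2))) + \<i> * of_real ((t - pi) / 2)"
    unfolding eq by (rule Ln_exp) (use t in auto)
  moreover have "1 - cis t \<noteq> 0" unfolding eq by simp
  ultimately have "(1 - cis t) powr of_real (- a)
      = exp (of_real (- a * ln (2 * sin (t / 2))) + \<i> * of_real (a * (pi - t) / 2))"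
    by (simp add: powr_def algebra_simps)
  also have "\<dots> = of_real (exp (- a * ln (2 * sin (t / 2)))) * cis (a * (pi - t) / 2)"
    by (simp only: exp_add cis_conv_exp exp_of_real)
  finally show ?thesis using s by (simp add: powr_def)
qed

lemma half_angle_ratio_tendsto: "((\<lambda>y. y / (2 * sin (y / 2))) \<longlongrightarrow> 1) (at_right (0::real))"
proof -
  have "((\<lambda>y::real. y / 2) \<longlongrightarrow> 0 / 2) (at_right 0)" by (intro tendsto_intros) auto
  then have "filterlim (\<lambda>y::real. y / 2) (at 0) (at_right 0)"
    unfolding filterlim_at by (auto intro!: eventually_mono[OF eventually_at_right_less])
  from filterlim_compose[OF sinc_at_0 this]
  have "((\<lambda>y::real. inverse (sin (y / 2) / (y / 2))) \<longlongrightarrow> inverse 1) (at_right 0)"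
    by (intro tendsto_inverse) auto
  then show ?thesis by (simp add: field_simps)
qed

lemma eventually_sin_half_pos: "\<forall>\<^sub>F y in at_right 0. 0 < y \<and> y < pi \<and> sin (y / 2) > (0::real)"
  unfolding eventually_at_right_field
  by (intro exI[of _ pi]) (auto intro!: sin_gt_zero)

lemma tendsto_powr_at_right_0:
  fixes a :: real
  assumes "a > 0"
  shows "((\<lambda>y. y powr a) \<longlongrightarrow> 0) (at_right 0)"
proof -
  have "((\<lambda>y::real. y powr a) \<longlongrightarrow> 0 powr a) (at_right 0)"
    by (rule tendsto_powr') (use assms in \<open>auto intro!: eventually_mono[OF eventually_at_right_less] tendsto_intros\<close>)
  then show ?thesis by simp
qed

text \<open>\<open>norm (1 - cis y)\<close> is asymptotic to \<open>y\<close>, so the product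
  behaves like \<open>y powr (a - b)\<close>.\<close>

lemma powr_norm_one_minus_cis_tendsto_0:
  assumes "b < a"
  shows "((\<lambda>y. y powr a * norm (1 - cis y) powr - b) \<longlongrightarrow> 0) (at_right 0)"
proof -
  have "((\<lambda>y::real. y powr (a - b)) \<longlongrightarrow> 0) (at_right 0)"
    by (rule tendsto_powr_at_right_0) (use assms in simp)
  moreover have "((\<lambda>y::real. (y / (2 * sin (y / 2))) powr b) \<longlongrightarrow> 1 powr b) (at_right 0)"
    by (intro tendsto_intros half_angle_ratio_tendsto) auto
  ultimately have "((\<lambda>y::real. y powr (a - b) * (y / (2 * sin (y / 2))) powr b) \<longlongrightarrow>
      0 * 1 powr b) (at_right 0)"
    by (rule tendsto_mult)
  then have "((\<lambda>y::real. y powr (a - b) * (y / (2 * sin (y / 2))) powr b) \<longlongrightarrow> 0) (at_right 0)"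
    by simp
  then show ?thesis
  proof (rule Lim_transform_eventually)
    show "\<forall>\<^sub>F y in at_right 0. y powr (a - b) * (y / (2 * sin (y / 2))) powr b
        = y powr a * norm (1 - cis y) powr - b"
      using eventually_sin_half_pos
    proof eventually_elim
      case (elim y)
      then have "(y / (2 * sin (y / 2))) powr b = y powr b * norm (1 - cis y) powr - b"
        by (simp add: norm_one_minus_cis powr_divide powr_minus_divide)
      then have "y powr (a - b) * (y / (2 * sin (y / 2))) powr b
          = (y powr (a - b) * y powr b) * norm (1 - cis y) powr - b"
        by (simp only: mult.assoc)
      then show ?case by (simp only: powr_add[symmetric]) simp
    qed
  qed
qed

text \<open>A bounded error vanishes after multiplication by \<open>y powr a\<close>, so by
  \<open>powr_series_near_binomial\<close> the series may be replaced by \<open>Gamma a\<close>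
  times the binomial power, whose modulus and phase are explicit.\<close>

lemma powr_series_asymp_pos:
  assumes a: "0 < a" "a < 1"
  shows "((\<lambda>y. of_real (y powr a) * (\<Sum>k. of_real (real k powr (a - 1)) * cis y ^ k))
    \<longlongrightarrow> of_real (Gamma a) * cis (a * pi / 2)) (at_right 0)"
proof -
  define Z where "Z y = (\<Sum>k. of_real (real k powr (a - 1)) * cis y ^ k)" for y
  have y0: "((\<lambda>y::real. y powr a) \<longlongrightarrow> 0) (at_right 0)"
    by (rule tendsto_powr_at_right_0[OF a(1)])
  have "((\<lambda>y. of_real (y powr a) * (Z y - of_real (Gamma a) * (1 - cis y) powr of_real (- a))) \<longlongrightarrow> 0) (at_right 0)"
  proof (rule Lim_null_comparison)
    show "((\<lambda>y::real. y powr a * (Gamma a + 1)) \<longlongrightarrow> 0) (at_right 0)"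
      using tendsto_mult_right[OF y0, of "Gamma a + 1"] by simp
    show "\<forall>\<^sub>F y in at_right 0. norm (of_real (y powr a) * (Z y - of_real (Gamma a) * (1 - cis y) powr of_real (- a)))
        \<le> y powr a * (Gamma a + 1)"
      using eventually_sin_half_pos
    proof eventually_elim
      case (elim y)
      have "norm (1 - cis y) > 0" using elim by (simp only: norm_one_minus_cis) simp
      then have "cis y \<noteq> 1" by auto
      then show ?case
        using powr_series_near_binomial[OF a, of "cis y"]
        by (auto simp: Z_def norm_mult intro!: mult_left_mono)
    qed
  qed
  \<comment> \<open>The factor \<open>y powr a * (2 * sin (y / 2)) powr - a\<close> appears here as
    a power of the ratio in \<open>half_angle_ratio_tendsto\<close>.\<close>
  moreover have "((\<lambda>y. of_real (Gamma a) * (of_real ((y / (2 * sin (y / 2))) powr a) * cis (a * (pi - y) / 2)))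
      \<longlongrightarrow> of_real (Gamma a) * (of_real (1 powr a) * cis (a * (pi - 0) / 2))) (at_right 0)"
    by (intro tendsto_intros half_angle_ratio_tendsto) auto
  ultimately have "((\<lambda>y. of_real (y powr a) * (Z y - of_real (Gamma a) * (1 - cis y) powr of_real (- a))
      + of_real (Gamma a) * (of_real ((y / (2 * sin (y / 2))) powr a) * cis (a * (pi - y) / 2)))
      \<longlongrightarrow> 0 + of_real (Gamma a) * (of_real (1 powr a) * cis (a * (pi - 0) / 2))) (at_right 0)"
    by (rule tendsto_add)
  then have "((\<lambda>y. of_real (y powr a) * Z y) \<longlongrightarrow>
      0 + of_real (Gamma a) * (of_real (1 powr a) * cis (a * (pi - 0) / 2))) (at_right 0)"
  proof (rule Lim_transform_eventually)
    show "\<forall>\<^sub>F y in at_right 0. of_real (y powr a) * (Z y - of_real (Gamma a) * (1 - cis y) powr of_real (- a))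
      + of_real (Gamma a) * (of_real ((y / (2 * sin (y / 2))) powr a) * cis (a * (pi - y) / 2))
      = of_real (y powr a) * Z y"
      using eventually_sin_half_pos
    proof eventually_elim
      case (elim y)
      have "(y / (2 * sin (y / 2))) powr a = y powr a * (2 * sin (y / 2)) powr - a"
        using elim by (simp add: powr_divide powr_minus_divide)
      then show ?case
        using elim by (subst one_minus_cis_powr) (auto simp: algebra_simps)
    qed
  qed
  then show ?thesis by (simp add: Z_def)
qed

text \<open>The coefficients are real, so changing the sign of \<open>y\<close> conjugates the
  series.\<close>

lemma powr_series_asymp_neg:
  assumes a: "0 < a" "a < 1"
  shows "((\<lambda>y. of_real (y powr a) * (\<Sum>k. of_real (real k powr (a - 1)) * cis (- y) ^ k))
    \<longlongrightarrow> of_real (Gamma a) * cis (- (a * pi / 2))) (at_right 0)"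
proof -
  obtain C where C: "power_decay C a (\<lambda>k. of_real (real k powr (a - 1)))"
    using power_decay_powr[OF a(2)] by blast
  have "((\<lambda>y. cnj (of_real (y powr a) * (\<Sum>k. of_real (real k powr (a - 1)) * cis y ^ k)))
      \<longlongrightarrow> cnj (of_real (Gamma a) * cis (a * pi / 2))) (at_right 0)"
    by (intro tendsto_cnj powr_series_asymp_pos a)
  then have "((\<lambda>y. cnj (of_real (y powr a) * (\<Sum>k. of_real (real k powr (a - 1)) * cis y ^ k)))
      \<longlongrightarrow> of_real (Gamma a) * cis (- (a * pi / 2))) (at_right 0)"
    by (simp add: cis_cnj)
  then show ?thesis
  proof (rule Lim_transform_eventually)
    show "\<forall>\<^sub>F y in at_right 0. cnj (of_real (y powr a) * (\<Sum>k. of_real (real k powr (a - 1)) * cis y ^ k))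
        = of_real (y powr a) * (\<Sum>k. of_real (real k powr (a - 1)) * cis (- y) ^ k)"
      using eventually_sin_half_pos
    proof eventually_elim
      case (elim y)
      have "norm (1 - cis y) > 0" using elim by (simp only: norm_one_minus_cis) simp
      then have "cis y \<noteq> 1" by auto
      then have "summable (\<lambda>k. of_real (real k powr (a - 1)) * cis y ^ k)"
        using power_decay_summable[OF C a(2)] by simp
      from bounded_linear.suminf[OF bounded_linear_cnj this]
      show ?case by (simp add: cis_cnj)
    qed
  qed
qed

subsection \<open>Nonnegativity of the spectral series\<close>

lemma sum_symmetric_interval:
  fixes u :: "int \<Rightarrow> 'a :: comm_monoid_add"
  shows "(\<Sum>h=- int n..int n. u h) = u 0 + (\<Sum>k<n. u (int (Suc k)) + u (- int (Suc k)))"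
proof (induction n)
  case (Suc n)
  have "{- int (Suc n)..int (Suc n)} = insert (int (Suc n)) (insert (- int (Suc n)) {- int n..int n})"
    by auto
  then have "(\<Sum>h=- int (Suc n)..int (Suc n). u h)
      = u (int (Suc n)) + (u (- int (Suc n)) + (\<Sum>h=- int n..int n. u h))"
    by simp
  then show ?case unfolding Suc.IH by (simp add: add_ac)
qed simp

text \<open>Enlarging the square from \<open>N\<close> to \<open>N + 1\<close> adds a row, a column
  and a corner, in which each difference \<open>h\<close> with \<open>\<bar>h\<bar> \<le> N\<close>
  occurs exactly once.\<close>

lemma sum_differences_eq_sum_partial_sums:
  fixes u :: "int \<Rightarrow> 'a :: comm_monoid_add"
  shows "(\<Sum>i<N. \<Sum>j<N. u (int i - int j)) = (\<Sum>n<N. \<Sum>h=- int n..int n. u h)"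
proof (induction N)
  case (Suc N)
  have "(\<Sum>j<N. u (int N - int j)) = (\<Sum>k<N. u (int (Suc k)))"
    by (subst sum.nat_diff_reindex[symmetric]) (auto intro!: sum.cong arg_cong[of _ _ u])
  moreover have "(\<Sum>i<N. u (int i - int N)) = (\<Sum>k<N. u (- int (Suc k)))"
    by (subst sum.nat_diff_reindex[symmetric]) (auto intro!: sum.cong arg_cong[of _ _ u])
  moreover have "(\<Sum>i<Suc N. \<Sum>j<Suc N. u (int i - int j)) =
     (\<Sum>i<N. \<Sum>j<N. u (int i - int j)) + (\<Sum>i<N. u (int i - int N)) + ((\<Sum>j<N. u (int N - int j)) + u 0)"
    by (simp add: sum.distrib add_ac)
  ultimately show ?case
    unfolding sum.lessThan_Suc[of _ N] sum_symmetric_interval[of u N] Suc.IH[symmetric]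
    by (simp add: sum.distrib add_ac)
qed simp

text \<open>A negative limit would make the sums decrease at least linearly, since from some index
  on every term is below \<open>s / 2\<close>.\<close>

lemma limit_nonneg_of_sums_nonneg:
  fixes S :: "nat \<Rightarrow> real"
  assumes S: "S \<longlonglongrightarrow> s" and nonneg: "\<And>N. 0 \<le> (\<Sum>n<N. S n)"
  shows "0 \<le> s"
proof (rule ccontr)
  assume "\<not> 0 \<le> s"
  then have s: "s < 0" by simp
  then have "\<forall>\<^sub>F n in sequentially. S n < s / 2" by (intro order_tendstoD(2)[OF S]) simp
  then obtain N where N: "\<And>n. n \<ge> N \<Longrightarrow> S n < s / 2" by (auto simp: eventually_sequentially)
  have bound: "(\<Sum>n<N + k. S n) \<le> (\<Sum>n<N. S n) + real k * (s / 2)" for k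
  proof (induction k)
    case (Suc k)
    have "S (N + k) \<le> s / 2" using N[of "N + k"] by simp
    moreover have "real (Suc k) * (s / 2) = real k * (s / 2) + s / 2" by (simp add: field_simps)
    moreover have "(\<Sum>n<N + Suc k. S n) = (\<Sum>n<N + k. S n) + S (N + k)" by simp
    ultimately show ?case using Suc by linarith
  qed simp
  obtain k :: nat where "(\<Sum>n<N. S n) < real k * (- s / 2)"
    using reals_Archimedean3[of "- s / 2"] s by auto
  then show False using bound[of k] nonneg[of "N + k"] by simp
qed

section \<open>Positive semidefiniteness of the autocovariance\<close>

lemma autocovariance_eq_covariance:
  assumes "second_order_stationary M X"
  shows "autocovariance M X (i - j) = covariance M (X i) (X j)"
proof -
  have "covariance M (X (j + (i - j))) (X j) = covariance M (X (i - j)) (X 0)"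
    using assms unfolding second_order_stationary_def by blast
  then show ?thesis by (simp add: autocovariance_def)
qed

lemma autocovariance_minus:
  assumes "second_order_stationary M X"
  shows "autocovariance M X (- h) = autocovariance M X h"
  using autocovariance_eq_covariance[OF assms, of 0 h] autocovariance_eq_covariance[OF assms, of h 0]
  by (simp add: covariance_def mult.commute)

text \<open>The quadratic form is the second moment of \<open>\<Sum>i<N. w i * Y i\<close>, where
  \<open>Y\<close> is the centred series.\<close>

lemma autocovariance_positive_semidefinite:
  fixes w :: "nat \<Rightarrow> real"
  assumes ss: "second_order_stationary M X"
  shows "0 \<le> (\<Sum>i<N. \<Sum>j<N. w i * w j * autocovariance M X (int i - int j))"
proof -
  interpret prob_space M using ss by (simp add: second_order_stationary_def)
  define Y where "Y n \<omega> = X (int n) \<omega> - expectation (X (int n))" for n \<omega>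
  have X[measurable]: "X n \<in> borel_measurable M" and X2: "integrable M (\<lambda>\<omega>. (X n \<omega>)\<^sup>2)" for n
    using ss by (auto simp: second_order_stationary_def)
  have X1: "integrable M (X n)" for n
    by (rule square_integrable_imp_integrable[OF X X2])
  have Y[measurable]: "Y n \<in> borel_measurable M" for n
    unfolding Y_def by measurable
  have Y2: "integrable M (\<lambda>\<omega>. (Y n \<omega>)\<^sup>2)" for n
  proof -
    have "integrable M (\<lambda>\<omega>. (X (int n) \<omega>)\<^sup>2 - 2 * expectation (X (int n)) * X (int n) \<omega>
        + (expectation (X (int n)))\<^sup>2)"
      by (intro Bochner_Integration.integrable_add Bochner_Integration.integrable_diff
          integrable_mult_right X2 X1 integrable_const)
    then show ?thesis by (simp add: Y_def power2_diff algebra_simps)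
  qed
  have YY: "integrable M (\<lambda>\<omega>. Y i \<omega> * Y j \<omega>)" for i j
  proof (rule Bochner_Integration.integrable_bound)
    show "integrable M (\<lambda>\<omega>. (Y i \<omega>)\<^sup>2 + (Y j \<omega>)\<^sup>2)"
      by (intro Bochner_Integration.integrable_add Y2)
    have "\<bar>a * b\<bar> \<le> a\<^sup>2 + b\<^sup>2" for a b :: real
      using sum_squares_bound[of "\<bar>a\<bar>" "\<bar>b\<bar>"] mult_nonneg_nonneg[of "\<bar>a\<bar>" "\<bar>b\<bar>"]
      by (simp add: abs_mult del: mult_nonneg_nonneg)
    then show "AE \<omega> in M. norm (Y i \<omega> * Y j \<omega>) \<le> norm ((Y i \<omega>)\<^sup>2 + (Y j \<omega>)\<^sup>2)"
      by (intro AE_I2) simp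
  qed measurable
  have cov: "autocovariance M X (int i - int j) = (LINT \<omega>|M. Y i \<omega> * Y j \<omega>)" for i j
    unfolding autocovariance_eq_covariance[OF ss] covariance_def Y_def ..
  have "0 \<le> (LINT \<omega>|M. (\<Sum>i<N. w i * Y i \<omega>)\<^sup>2)"
    by simp
  also have "\<dots> = (LINT \<omega>|M. (\<Sum>i<N. \<Sum>j<N. w i * w j * (Y i \<omega> * Y j \<omega>)))"
    by (simp add: power2_eq_square sum_product mult_ac)
  also have "\<dots> = (\<Sum>i<N. \<Sum>j<N. w i * w j * autocovariance M X (int i - int j))"
    unfolding cov
    by (subst Bochner_Integration.integral_sum,
        (intro Bochner_Integration.integrable_sum integrable_mult_right YY),
        intro sum.cong refl,
        subst Bochner_Integration.integral_sum,
        (intro integrable_mult_right YY)) simp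
  finally show ?thesis .
qed

text \<open>
  Up to the factor \<open>2 \<pi> N\<close>, the sum is a Cesaro mean of the spectral series, and it is the
  variance of \<open>\<Sum>j<N. X\<^sub>j exp (- i j x)\<close>.
\<close>

lemma Fejer_sum_nonneg:
  assumes ss: "second_order_stationary M X"
  shows "0 \<le> (\<Sum>n<N. \<Sum>h=- int n..int n. autocovariance M X h * cos (of_int h * x))"
proof -
  \<comment> \<open>The weights \<open>cos\<close> and \<open>sin\<close> stand for the real and
    imaginary parts of the exponential; the addition formula merges the two forms into
    \<open>cos ((i - j) * x)\<close>.\<close>
  have "0 \<le> (\<Sum>i<N. \<Sum>j<N. cos (real i * x) * cos (real j * x) * autocovariance M X (int i - int j))
      + (\<Sum>i<N. \<Sum>j<N. sin (real i * x) * sin (real j * x) * autocovariance M X (int i - int j))"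
    by (intro add_nonneg_nonneg autocovariance_positive_semidefinite ss)
  also have "\<dots> = (\<Sum>i<N. \<Sum>j<N. autocovariance M X (int i - int j) * cos (of_int (int i - int j) * x))"
    by (simp add: cos_diff left_diff_distrib algebra_simps flip: sum.distrib)
  also have "\<dots> = (\<Sum>n<N. \<Sum>h=- int n..int n. autocovariance M X h * cos (of_int h * x))"
    by (rule sum_differences_eq_sum_partial_sums)
  finally show ?thesis .
qed

subsection \<open>The sum of the spectral series is a spectral density\<close>

text \<open>The majorant is the power cut off to \<open>{- T..T}\<close> and extended by zero. Being
  integrable on the whole line, it can later be translated to both singularities.\<close>

lemma integrable_powr_singularity:
  fixes a T :: real
  assumes a: "a < 1" and T: "T \<ge> 0"
  obtains h :: "real \<Rightarrow> real" where "integrable lborel h" "\<And>x. 0 \<le> h x"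
    "\<And>x. \<bar>x\<bar> \<le> T \<Longrightarrow> \<bar>x\<bar> powr - a \<le> h x"
proof -
  define g where "g x = indicator {0..T} x * x powr - a" for x :: real
  have "((\<lambda>x. x powr - a) has_integral (T powr (- a + 1) / (- a + 1))) {0..T}"
    by (rule has_integral_powr_from_0) (use a T in auto)
  then have "(\<lambda>x. x powr - a) absolutely_integrable_on {0..T}"
    by (intro nonnegative_absolutely_integrable_1) (auto simp: integrable_on_def)
  then have "integrable lebesgue g"
    by (simp add: set_integrable_def g_def[abs_def])
  moreover have "g \<in> borel_measurable lborel"
    unfolding g_def by measurable
  ultimately have g: "integrable lborel g"
    by (simp add: integrable_completion)
  have "integrable lborel (\<lambda>x. g (0 + (- 1) * x))"
    by (rule lborel_integrable_real_affine[OF g]) simp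
  then have "integrable lborel (\<lambda>x. g x + g (- x))"
    using g by simp
  moreover have "0 \<le> g x + g (- x)" for x by (simp add: g_def)
  moreover have "\<bar>x\<bar> powr - a \<le> g x + g (- x)" if "\<bar>x\<bar> \<le> T" for x
    using that by (cases "x \<ge> 0") (auto simp: g_def indicator_def)
  ultimately show thesis using that by blast
qed

text \<open>Since \<open>norm (1 - cis t) = \<bar>sinc (t / 2)\<bar> * \<bar>t\<bar>\<close> and
  \<open>sinc (t / 2)\<close> is continuous without zeros for
  \<open>\<bar>t\<bar> \<le> T < 2 * pi\<close>, the minimum of its modulus serves as
  \<open>\<kappa>\<close>.\<close>

lemma norm_one_minus_cis_lower_bound:
  assumes T: "0 \<le> T" "T < 2 * pi"
  obtains \<kappa> where "\<kappa> > 0" "\<And>t. \<bar>t\<bar> \<le> T \<Longrightarrow> \<kappa> * \<bar>t\<bar> \<le> norm (1 - cis t)"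
proof -
  have "continuous_on {- T..T} (\<lambda>t. \<bar>sinc (t / 2)\<bar>)"
    by (intro continuous_on_rabs continuous_on_sinc continuous_on_divide continuous_on_id continuous_on_const) simp
  then have "\<exists>s\<in>{- T..T}. \<forall>t\<in>{- T..T}. \<bar>sinc (s / 2)\<bar> \<le> \<bar>sinc (t / 2)\<bar>"
    by (intro continuous_attains_inf) (use T in auto)
  then obtain s where s: "s \<in> {- T..T}" "\<And>t. t \<in> {- T..T} \<Longrightarrow> \<bar>sinc (s / 2)\<bar> \<le> \<bar>sinc (t / 2)\<bar>"
    by blast
  have "sin (s / 2) \<noteq> 0" if "s \<noteq> 0"
  proof (cases "s > 0")
    case True
    then show ?thesis using sin_gt_zero[of "s / 2"] s T by auto
  next
    case False
    then show ?thesis using sin_gt_zero[of "- s / 2"] s T that by auto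
  qed
  then have pos: "\<bar>sinc (s / 2)\<bar> > 0" by auto
  show thesis
  proof (rule that[OF pos])
    fix t assume t: "\<bar>t\<bar> \<le> T"
    then have "\<bar>sinc (s / 2)\<bar> * \<bar>t\<bar> \<le> \<bar>sinc (t / 2)\<bar> * \<bar>t\<bar>"
      by (intro mult_right_mono s) auto
    also have "\<dots> = norm (1 - cis t)"
      unfolding norm_one_minus_cis by (auto simp: abs_divide)
    finally show "\<bar>sinc (s / 2)\<bar> * \<bar>t\<bar> \<le> norm (1 - cis t)" .
  qed
qed

lemma set_integral_cis:
  "(LINT x:{- pi..pi}|lborel. cis (of_int n * x)) = (if n = 0 then of_real (2 * pi) else 0)"
proof (cases "n = 0")
  case True
  then show ?thesis by (simp add: set_lebesgue_integral_def scaleR_conv_of_real)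
next
  case False
  have "(LINT x|lborel. indicator {- pi..pi} x *\<^sub>R cis (of_int n * x))
      = - \<i> / of_int n * cis (of_int n * pi) - (- \<i> / of_int n * cis (of_int n * (- pi)))"
  proof (rule integral_FTC_Icc)
    show "((\<lambda>x. - \<i> / of_int n * cis (of_int n * x)) has_vector_derivative cis (of_int n * x))
        (at x within {- pi..pi})" for x
      unfolding cis_conv_exp using False
      by (auto intro!: derivative_eq_intros has_vector_derivative_real_field simp: field_simps)
    show "continuous_on {- pi..pi} (\<lambda>x. cis (of_int n * x))"
      by (intro continuous_intros)
  qed simp
  also have "cis (of_int n * (- pi)) = cis (of_int n * pi)"
    using sin_zero_iff_int2[of "of_int n * pi"] by (auto simp: complex_eq_iff)
  finally show ?thesis using False by (simp add: set_lebesgue_integral_def)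
qed

lemma set_integral_trigonometric_partial_sum:
  fixes \<gamma> :: "int \<Rightarrow> real"
  assumes "\<bar>h\<bar> \<le> int N"
  shows "(LINT x:{- pi..pi}|lborel. cis (of_int h * x) *
      (1 / (2 * of_real pi) * (\<Sum>k=- int N..int N. cis (- (of_int k * x)) * of_real (\<gamma> k)))) = of_real (\<gamma> h)"
proof -
  have int: "set_integrable lborel {- pi..pi} (\<lambda>x. cis (of_int (h - k) * x))" for k
    by (rule borel_integrable_atLeastAtMost') (intro continuous_intros)
  have "(LINT x:{- pi..pi}|lborel. cis (of_int h * x) *
      (1 / (2 * of_real pi) * (\<Sum>k=- int N..int N. cis (- (of_int k * x)) * of_real (\<gamma> k))))
      = (LINT x:{- pi..pi}|lborel. (\<Sum>k=- int N..int N. of_real (\<gamma> k / (2 * pi)) * cis (of_int (h - k) * x)))"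
    by (simp add: sum_distrib_left cis_mult left_diff_distrib mult_ac flip: mult.assoc)
       (simp add: right_diff_distrib mult_ac)
  also have "\<dots> = (\<Sum>k=- int N..int N. (LINT x:{- pi..pi}|lborel. of_real (\<gamma> k / (2 * pi)) * cis (of_int (h - k) * x)))"
    unfolding set_lebesgue_integral_def scaleR_sum_right
    by (intro Bochner_Integration.integral_sum set_integrable_mult_right[unfolded set_integrable_def]
        int[unfolded set_integrable_def])
  also have "\<dots> = (\<Sum>k=- int N..int N. if k = h then of_real (\<gamma> k) else 0)"
    unfolding set_integral_mult_right set_integral_cis by (intro sum.cong refl) auto
  also have "\<dots> = of_real (\<gamma> h)"
    using assms by (subst sum.delta) auto
  finally show ?thesis .
qed

text \<open>Evenness and nonnegative Cesaro sums stand in for the stationary series. The value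
  \<open>0\<close> of \<open>f\<close> at \<open>\<plusminus> lam\<close> concerns only a null set;
  the value \<open>0\<close> outside \<open>[- pi, pi]\<close> lets integrals over the interval be
  taken over the line.\<close>

lemma spectral_density_of_power_decay:
  fixes \<gamma> :: "int \<Rightarrow> real" and A :: "nat \<Rightarrow> complex" and lam :: real
  assumes even: "\<And>h. \<gamma> (- h) = \<gamma> h"
    and nonneg: "\<And>x N. 0 \<le> (\<Sum>n<N. \<Sum>h=- int n..int n. \<gamma> h * cos (of_int h * x))"
    and A: "power_decay C a A" and a: "0 < a" "a < 1" and A0: "A 0 = 0"
    and \<gamma>A: "\<And>k. k \<ge> 1 \<Longrightarrow> \<gamma> (int k) = Re (A k * cis (real k * lam))"
    and lam: "0 < lam" "lam < pi"
  defines "F \<equiv> \<lambda>t. \<Sum>k. A k * cis t ^ k"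
  defines "f \<equiv> \<lambda>x. if \<bar>x\<bar> \<le> pi \<and> \<bar>x\<bar> \<noteq> lam
    then (\<gamma> 0 + Re (F (lam + x)) + Re (F (lam - x))) / (2 * pi) else 0"
  shows "spectral_density \<gamma> f"
    and "\<And>x. \<bar>x\<bar> \<le> pi \<Longrightarrow> \<bar>x\<bar> \<noteq> lam \<Longrightarrow> spectral_series_sums \<gamma> x (f x)"
proof -
  \<comment> \<open>\<open>P\<close> is the symmetric partial sum, real by evenness of
    \<open>\<gamma>\<close> and written through the partial sums of \<open>F\<close>;
    \<open>S\<close> is the same sum in the form required by
    \<open>spectral_series_sums\<close>.\<close>
  define P where "P N x = (\<gamma> 0 + Re (\<Sum>k<Suc N. A k * cis (lam + x) ^ k)
      + Re (\<Sum>k<Suc N. A k * cis (lam - x) ^ k)) / (2 * pi)" for N x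
  define S where "S N x = 1 / (2 * complex_of_real pi) *
        (\<Sum>h = - int N..int N. cis (- (of_int h * x)) * complex_of_real (\<gamma> h))" for N x
  have P_eq: "P N x = 1 / (2 * pi) * (\<Sum>h=- int N..int N. \<gamma> h * cos (of_int h * x))" for N x
  proof -
    have pair: "Re (A k * cis (lam + x) ^ k) + Re (A k * cis (lam - x) ^ k) = 2 * \<gamma> (int k) * cos (real k * x)"
      if "k \<ge> 1" for k
    proof -
      have eqs: "A k * cis (lam + x) ^ k = (A k * cis (real k * lam)) * cis (real k * x)"
        "A k * cis (lam - x) ^ k = (A k * cis (real k * lam)) * cis (- (real k * x))"
        by (simp_all add: Complex.DeMoivre cis_mult algebra_simps)
      show ?thesis unfolding eqs \<gamma>A[OF that] by (simp add: algebra_simps)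
    qed
    have "Re (\<Sum>k<Suc N. A k * cis (lam + x) ^ k) + Re (\<Sum>k<Suc N. A k * cis (lam - x) ^ k)
        = (\<Sum>k<N. Re (A (Suc k) * cis (lam + x) ^ Suc k) + Re (A (Suc k) * cis (lam - x) ^ Suc k))"
      unfolding sum.lessThan_Suc_shift A0 Re_sum[symmetric] sum.distrib by simp
    also have "\<dots> = (\<Sum>k<N. 2 * \<gamma> (int (Suc k)) * cos (real (Suc k) * x))"
      by (intro sum.cong refl pair) simp
    also have "\<gamma> 0 + \<dots> = (\<Sum>h=- int N..int N. \<gamma> h * cos (of_int h * x))"
      unfolding sum_symmetric_interval even of_int_minus mult_minus_left cos_minus
      by (simp add: algebra_simps)
    finally show ?thesis by (simp add: P_def add.assoc)
  qed
  have S_eq: "S N x = complex_of_real (P N x)" for N x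
  proof -
    have "(\<Sum>h = - int N..int N. cis (- (of_int h * x)) * complex_of_real (\<gamma> h))
        = complex_of_real (\<Sum>h=- int N..int N. \<gamma> h * cos (of_int h * x))"
      unfolding sum_symmetric_interval of_real_add of_real_sum even of_int_minus mult_minus_left
        minus_minus cos_minus
      by (simp add: complex_eq_iff mult.commute)
    then show ?thesis by (simp add: S_def P_eq)
  qed
  \<comment> \<open>For \<open>\<bar>x\<bar> \<le> pi\<close> both \<open>lam + x\<close> and
    \<open>lam - x\<close> have modulus at most \<open>lam + pi < 2 * pi\<close>, a range in which
    \<open>0\<close> is the only singular angle.\<close>
  obtain \<kappa> where \<kappa>: "\<kappa> > 0" "\<And>t. \<bar>t\<bar> \<le> lam + pi \<Longrightarrow> \<kappa> * \<bar>t\<bar> \<le> norm (1 - cis t)"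
    using norm_one_minus_cis_lower_bound[of "lam + pi"] lam by auto
  have ne1: "cis t \<noteq> 1" if "\<bar>t\<bar> \<le> lam + pi" "t \<noteq> 0" for t
  proof -
    have "0 < \<kappa> * \<bar>t\<bar>" using \<kappa> that by simp
    then show ?thesis using \<kappa>(2)[OF that(1)] by auto
  qed
  have Flim: "(\<lambda>N. \<Sum>k<Suc N. A k * cis t ^ k) \<longlonglongrightarrow> F t" if "\<bar>t\<bar> \<le> lam + pi" "t \<noteq> 0" for t
    unfolding F_def using ne1[OF that]
    by (intro LIMSEQ_Suc summable_LIMSEQ power_decay_summable[OF A a(2)]) auto
  have Plim: "(\<lambda>N. P N x) \<longlonglongrightarrow> f x" if x: "\<bar>x\<bar> \<le> pi" "\<bar>x\<bar> \<noteq> lam" for x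
  proof -
    have "(\<lambda>N. P N x) \<longlonglongrightarrow> (\<gamma> 0 + Re (F (lam + x)) + Re (F (lam - x))) / (2 * pi)"
      unfolding P_def using x lam by (intro tendsto_intros Flim) auto
    then show ?thesis using x by (simp add: f_def)
  qed
  show "spectral_series_sums \<gamma> x (f x)" if "\<bar>x\<bar> \<le> pi" "\<bar>x\<bar> \<noteq> lam" for x
    unfolding spectral_series_sums_def S_def[symmetric] S_eq
    by (intro tendsto_of_real Plim that)
  have f_nonneg: "0 \<le> f x" for x
  proof (cases "\<bar>x\<bar> \<le> pi \<and> \<bar>x\<bar> \<noteq> lam")
    case True
    show ?thesis
    proof (rule limit_nonneg_of_sums_nonneg[OF Plim])
      show "0 \<le> (\<Sum>n<N. P n x)" for N
        unfolding P_eq sum_distrib_left[symmetric] by (intro mult_nonneg_nonneg nonneg) simp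
    qed (use True in auto)
  qed (auto simp: f_def)
  obtain g :: "real \<Rightarrow> real" where g: "integrable lborel g" "\<And>x. 0 \<le> g x"
    "\<And>x. \<bar>x\<bar> \<le> lam + pi \<Longrightarrow> \<bar>x\<bar> powr - a \<le> g x"
    using integrable_powr_singularity[OF a(2), of "lam + pi"] lam by auto
  define K where "K = (C / a + 3 * C) * \<kappa> powr - a"
  have C: "C \<ge> 0" by (rule power_decay_nonneg[OF A])
  have K: "K \<ge> 0" using C a by (simp add: K_def)
  have Fbound: "norm (\<Sum>k<N. A k * cis t ^ k) \<le> K * g t" if t: "\<bar>t\<bar> \<le> lam + pi" "t \<noteq> 0" for t N
  proof -
    have "norm (\<Sum>k<N. A k * cis t ^ k) \<le> (C / a + 3 * C) * norm (1 - cis t) powr - a"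
      by (rule power_decay_bound[OF A a A0]) (use ne1[OF t] in auto)
    also have "\<dots> \<le> (C / a + 3 * C) * (\<kappa> * \<bar>t\<bar>) powr - a"
      using \<kappa>(1) \<kappa>(2)[OF t(1)] t C a by (intro mult_left_mono powr_mono2') auto
    also have "\<dots> = K * \<bar>t\<bar> powr - a"
      by (simp add: K_def powr_mult)
    also have "\<dots> \<le> K * g t"
      using K g(3)[OF t(1)] by (rule mult_left_mono[rotated])
    finally show ?thesis .
  qed
  \<comment> \<open>Majorant for all \<open>N\<close> at once: translates of \<open>g\<close> sit at
    the singularities \<open>- lam\<close> and \<open>lam\<close>, and the indicator keeps the
    constant \<open>\<bar>\<gamma> 0\<bar>\<close> integrable.\<close>
  define w where "w x = indicator {- pi..pi} x * \<bar>\<gamma> 0\<bar> + (K * g (lam + x) + K * g (lam - x))" for x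
  have gint: "integrable lborel (\<lambda>x. g (lam + x))" "integrable lborel (\<lambda>x. g (lam - x))"
    using lborel_integrable_real_affine[OF g(1), of 1 lam] lborel_integrable_real_affine[OF g(1), of "-1" lam]
    by simp_all
  have wint: "integrable lborel w"
    unfolding w_def
    by (intro Bochner_Integration.integrable_add integrable_mult_right gint integrable_mult_left
        integrable_real_indicator) auto
  have Pbound: "\<bar>P N x\<bar> \<le> w x" if x: "\<bar>x\<bar> \<le> pi" "\<bar>x\<bar> \<noteq> lam" for N x
  proof -
    have t: "\<bar>lam + x\<bar> \<le> lam + pi" "lam + x \<noteq> 0" "\<bar>lam - x\<bar> \<le> lam + pi" "lam - x \<noteq> 0"
      using x lam by auto
    have triangle: "\<bar>p + q + r\<bar> \<le> \<bar>p\<bar> + u + v" if "\<bar>q\<bar> \<le> u" "\<bar>r\<bar> \<le> v" for p q r u v :: real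
      using that by linarith
    have R: "\<bar>Re (\<Sum>k<Suc N. A k * cis (lam + x) ^ k)\<bar> \<le> K * g (lam + x)"
      "\<bar>Re (\<Sum>k<Suc N. A k * cis (lam - x) ^ k)\<bar> \<le> K * g (lam - x)"
      by (rule order.trans[OF abs_Re_le_cmod Fbound]; fact t)+
    have "\<bar>P N x\<bar> \<le> \<bar>\<gamma> 0 + Re (\<Sum>k<Suc N. A k * cis (lam + x) ^ k)
      + Re (\<Sum>k<Suc N. A k * cis (lam - x) ^ k)\<bar> / 1"
      unfolding P_def abs_divide using pi_gt3 by (intro divide_left_mono) auto
    also have "\<dots> \<le> \<bar>\<gamma> 0\<bar> + K * g (lam + x) + K * g (lam - x)"
      unfolding div_by_1 by (rule triangle[OF R])
    finally show ?thesis using x by (simp add: w_def indicator_def abs_le_iff)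
  qed
  \<comment> \<open>Setting the partial sums to \<open>0\<close> at the exceptional points makes
    them converge to \<open>f\<close> everywhere, which yields Borel measurability of
    \<open>f\<close>.\<close>
  define P' where "P' N x = (if \<bar>x\<bar> \<le> pi \<and> \<bar>x\<bar> \<noteq> lam then P N x else 0)" for N x
  have P'lim: "(\<lambda>N. P' N x) \<longlonglongrightarrow> f x" for x
  proof (cases "\<bar>x\<bar> \<le> pi \<and> \<bar>x\<bar> \<noteq> lam")
    case True
    then show ?thesis using Plim[of x] by (simp add: P'_def)
  next
    case False
    then have "f x = 0" "\<And>N. P' N x = 0" by (auto simp: f_def P'_def)
    then show ?thesis by simp
  qed
  have wnn: "0 \<le> w x" for x using K g(2) by (auto simp: w_def)
  have P'bound: "\<bar>P' N x\<bar> \<le> w x" for N x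
    using Pbound[of x N] wnn[of x] by (auto simp: P'_def)
  have [measurable]: "P N \<in> borel_measurable borel" for N
    unfolding P_eq[abs_def] by measurable
  have P'meas[measurable]: "P' N \<in> borel_measurable borel" for N
    unfolding P'_def[abs_def] by measurable
  have fmeas[measurable]: "f \<in> borel_measurable borel"
    by (rule borel_measurable_LIMSEQ_real[OF P'lim]) simp
  have fint: "integrable lborel f"
    by (rule integrable_dominated_convergence[OF _ _ wint, of f P'])
       (auto intro!: P'lim P'bound)
  have f_ind: "indicator {- pi..pi} x *\<^sub>R f x = f x" for x
    by (auto simp: f_def indicator_def)
  \<comment> \<open>Both sides are limits of the same integrals: by orthogonality the coefficient of
    the partial sum is exactly \<open>\<gamma> h\<close> once \<open>N \<ge> \<bar>h\<bar>\<close>,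
    and dominated convergence gives the coefficient of \<open>f\<close>.\<close>
  have coeff: "complex_of_real (\<gamma> h) =
        (LINT x:{- pi..pi}|lborel. cis (of_int h * x) * complex_of_real (f x))" for h
  proof (rule LIMSEQ_unique)
    define s where "s N x = indicator {- pi..pi} x *\<^sub>R (cis (of_int h * x) * complex_of_real (P N x))" for N x
    have [measurable]: "(\<lambda>x. cis (of_int h * x)) \<in> borel_measurable borel"
      by (intro borel_measurable_continuous_onI continuous_intros)
    have ae: "AE x in lborel. \<bar>x\<bar> \<noteq> lam"
      using AE_lborel_singleton[of lam] AE_lborel_singleton[of "- lam"] by eventually_elim auto
    have "(\<lambda>N. integral\<^sup>L lborel (s N)) \<longlonglongrightarrow>
        integral\<^sup>L lborel (\<lambda>x. indicator {- pi..pi} x *\<^sub>R (cis (of_int h * x) * complex_of_real (f x)))"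
    proof (rule integral_dominated_convergence[OF _ _ wint])
      show "AE x in lborel. (\<lambda>N. s N x) \<longlonglongrightarrow>
          indicator {- pi..pi} x *\<^sub>R (cis (of_int h * x) * complex_of_real (f x))"
        using ae
      proof eventually_elim
        case (elim x)
        show ?case
        proof (cases "\<bar>x\<bar> \<le> pi")
          case True
          then show ?thesis unfolding s_def
            by (intro tendsto_intros Plim elim)
        next
          case False
          then have "x \<notin> {- pi..pi}" by auto
          then show ?thesis by (simp add: s_def)
        qed
      qed
      show "AE x in lborel. norm (s N x) \<le> w x" for N
        using ae
      proof eventually_elim
        case (elim x)
        then show ?case using Pbound[of x N] wnn[of x]
          by (auto simp: s_def norm_mult indicator_def abs_le_iff)
      qed
    qed (unfold s_def[abs_def], measurable)
    then show "(\<lambda>N. integral\<^sup>L lborel (s N)) \<longlonglongrightarrow>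
        (LINT x:{- pi..pi}|lborel. cis (of_int h * x) * complex_of_real (f x))"
      by (simp add: set_lebesgue_integral_def)
    have "integral\<^sup>L lborel (s N) = of_real (\<gamma> h)" if "N \<ge> nat \<bar>h\<bar>" for N
      using set_integral_trigonometric_partial_sum[of h N \<gamma>] that
      unfolding S_def[symmetric] S_eq set_lebesgue_integral_def s_def[symmetric] by simp
    then show "(\<lambda>N. integral\<^sup>L lborel (s N)) \<longlonglongrightarrow> complex_of_real (\<gamma> h)"
      by (intro tendsto_eventually eventually_sequentiallyI)
  qed
  show "spectral_density \<gamma> f"
    unfolding spectral_density_def set_integrable_def f_ind
    using f_nonneg fint coeff by auto
qed

subsection \<open>Behaviour near the singularity\<close>

text \<open>Near an angle that is not a multiple of \<open>2 * pi\<close> the series stays bounded,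
  so the factor \<open>y powr a\<close> sends the product to \<open>0\<close>.\<close>

lemma power_decay_series_bounded_away:
  assumes A: "power_decay C a A" and a: "0 < a" "a < 1" and A0: "A 0 = 0"
    and t: "(t \<longlongrightarrow> s) (at_right (0::real))" and s: "0 < s" "s < 2 * pi"
  shows "((\<lambda>y. of_real (y powr a) * (\<Sum>k. A k * cis (t y) ^ k)) \<longlongrightarrow> 0) (at_right 0)"
proof (rule Lim_null_comparison)
  have "norm (1 - cis s) > 0"
    using sin_gt_zero[of "s / 2"] s unfolding norm_one_minus_cis by auto
  then have nz: "1 - cis s \<noteq> 0" by auto
  have lim: "((\<lambda>y. norm (1 - cis (t y))) \<longlongrightarrow> norm (1 - cis s)) (at_right 0)"
    by (intro tendsto_intros t)
  have "((\<lambda>y. y powr a * ((C / a + 3 * C) * norm (1 - cis (t y)) powr - a)) \<longlongrightarrow>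
      0 * ((C / a + 3 * C) * norm (1 - cis s) powr - a)) (at_right 0)"
    by (intro tendsto_intros tendsto_powr_at_right_0 a t) (use nz in auto)
  then show "((\<lambda>y. y powr a * ((C / a + 3 * C) * norm (1 - cis (t y)) powr - a)) \<longlongrightarrow> 0) (at_right 0)"
    by simp
  have "\<forall>\<^sub>F y in at_right 0. 0 < norm (1 - cis (t y))"
    by (rule order_tendstoD(1)[OF lim]) (use nz in simp)
  then show "\<forall>\<^sub>F y in at_right 0. norm (of_real (y powr a) * (\<Sum>k. A k * cis (t y) ^ k))
      \<le> y powr a * ((C / a + 3 * C) * norm (1 - cis (t y)) powr - a)"
  proof eventually_elim
    case (elim y)
    then have "cis (t y) \<noteq> 1" by auto
    then show ?case
      using power_decay_suminf_bound[OF A a A0, of "cis (t y)"]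
      by (auto simp: norm_mult intro!: mult_left_mono)
  qed
qed

text \<open>Coefficients with exponent \<open>b < a\<close> contribute only order
  \<open>y powr - b\<close>; this disposes of the slowly varying terms.\<close>

lemma power_decay_series_lower_order:
  assumes A: "power_decay C b A" and b: "0 < b" "b < 1" "b < a" and A0: "A 0 = 0"
    and s: "s = 1 \<or> s = -1"
  shows "((\<lambda>y. of_real (y powr a) * (\<Sum>k. A k * cis (s * y) ^ k)) \<longlongrightarrow> 0) (at_right 0)"
proof (rule Lim_null_comparison)
  have nrm: "norm (1 - cis (s * y)) = norm (1 - cis y)" for y
    using s by (auto simp: norm_one_minus_cis)
  show "((\<lambda>y. (C / b + 3 * C) * (y powr a * norm (1 - cis y) powr - b)) \<longlongrightarrow> 0) (at_right 0)"
    using tendsto_mult_left[OF powr_norm_one_minus_cis_tendsto_0[OF b(3)], of "C / b + 3 * C"] by simp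
  show "\<forall>\<^sub>F y in at_right 0. norm (of_real (y powr a) * (\<Sum>k. A k * cis (s * y) ^ k))
      \<le> (C / b + 3 * C) * (y powr a * norm (1 - cis y) powr - b)"
    using eventually_sin_half_pos
  proof eventually_elim
    case (elim y)
    have "norm (1 - cis (s * y)) > 0" unfolding nrm using elim by (simp only: norm_one_minus_cis) simp
    then have "cis (s * y) \<noteq> 1" by auto
    then have "norm (\<Sum>k. A k * cis (s * y) ^ k) \<le> (C / b + 3 * C) * norm (1 - cis y) powr - b"
      using power_decay_suminf_bound[OF A b(1,2) A0, of "cis (s * y)"] by (simp add: nrm)
    from mult_left_mono[OF this, of "y powr a"] show ?case
      by (simp add: norm_mult mult_ac)
  qed
qed

lemma perturbed_powr_series_asymp:
  assumes E: "power_decay C b E" and b: "0 < b" "b < a" and a: "a < 1" and E0: "E 0 = 0"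
    and s: "s = 1 \<or> s = -1"
  shows "((\<lambda>y. of_real (y powr a) * (\<Sum>k. (w * of_real (real k powr (a - 1)) + E k) * cis (s * y) ^ k))
    \<longlongrightarrow> w * (of_real (Gamma a) * cis (s * (a * pi / 2)))) (at_right 0)"
proof -
  obtain C' where C': "power_decay C' a (\<lambda>k. of_real (real k powr (a - 1)))"
    using power_decay_powr[OF a] by blast
  have a0: "0 < a" and b1: "b < 1" using a b by auto
  have "((\<lambda>y. of_real (y powr a) * (\<Sum>k. of_real (real k powr (a - 1)) * cis (s * y) ^ k))
    \<longlongrightarrow> of_real (Gamma a) * cis (s * (a * pi / 2))) (at_right 0)"
    using s powr_series_asymp_pos[OF a0 a] powr_series_asymp_neg[OF a0 a] by auto
  from tendsto_add[OF tendsto_mult_left[OF this, of w] power_decay_series_lower_order[OF E b(1) b1 b(2) E0 s]]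
  have "((\<lambda>y. w * (of_real (y powr a) * (\<Sum>k. of_real (real k powr (a - 1)) * cis (s * y) ^ k))
      + of_real (y powr a) * (\<Sum>k. E k * cis (s * y) ^ k))
    \<longlongrightarrow> w * (of_real (Gamma a) * cis (s * (a * pi / 2)))) (at_right 0)"
    by simp
  then show ?thesis
  proof (rule Lim_transform_eventually)
    show "\<forall>\<^sub>F y in at_right 0. w * (of_real (y powr a) * (\<Sum>k. of_real (real k powr (a - 1)) * cis (s * y) ^ k))
      + of_real (y powr a) * (\<Sum>k. E k * cis (s * y) ^ k)
      = of_real (y powr a) * (\<Sum>k. (w * of_real (real k powr (a - 1)) + E k) * cis (s * y) ^ k)"
      using eventually_sin_half_pos
    proof eventually_elim
      case (elim y)
      have "norm (1 - cis (s * y)) > 0" using elim s by (auto simp: norm_one_minus_cis)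
      then have z: "norm (cis (s * y)) = 1" "cis (s * y) \<noteq> 1" by auto
      have "(\<lambda>k. w * (of_real (real k powr (a - 1)) * cis (s * y) ^ k) + E k * cis (s * y) ^ k) sums
        (w * (\<Sum>k. of_real (real k powr (a - 1)) * cis (s * y) ^ k) + (\<Sum>k. E k * cis (s * y) ^ k))"
        by (intro sums_add sums_mult summable_sums power_decay_summable[OF C' a z]
            power_decay_summable[OF E b1 z])
      then have "(\<Sum>k. (w * of_real (real k powr (a - 1)) + E k) * cis (s * y) ^ k) =
        w * (\<Sum>k. of_real (real k powr (a - 1)) * cis (s * y) ^ k) + (\<Sum>k. E k * cis (s * y) ^ k)"
        by (simp add: sums_iff distrib_right mult.assoc)
      then show ?case by (simp add: algebra_simps)
    qed
  qed
qed

theorem propositionC3: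
  fixes M :: "'a measure" and X :: "int \<Rightarrow> 'a \<Rightarrow> real"
    and lam\<^sub>0 d c\<^sub>\<gamma> \<phi> \<epsilon> \<xi> b\<^sub>1 b\<^sub>2 :: real
    and L\<^sub>1 L\<^sub>2 :: "real \<Rightarrow> real" and R\<^sub>\<gamma> :: "nat \<Rightarrow> real"
  assumes "lam\<^sub>0 \<in> {0<..<pi}" and "d \<in> {0<..<1/2}" and "c\<^sub>\<gamma> > 0"
    and "\<phi> = (1/2 - d) * pi"
    and "second_order_stationary M X"
    and "\<And>h::nat. h \<ge> 1 \<Longrightarrow>
      autocovariance M X (int h) =
        (c\<^sub>\<gamma> * cos (lam\<^sub>0 * real h + \<phi>) + R\<^sub>\<gamma> h) * real h powr (2 * d - 1)"
    and "\<And>h::nat. h \<ge> 1 \<Longrightarrow>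
      R\<^sub>\<gamma> h = L\<^sub>1 (real h) * cos (lam\<^sub>0 * real h) * real h powr (- 2 * \<epsilon>)
        + \<xi> * L\<^sub>2 (real h) * sin (lam\<^sub>0 * real h) * real h powr (- 2 * \<epsilon>)"
    and "\<epsilon> \<in> {0<..<d}" and "\<xi> \<in> {1, -1}"
    and "quasi_monotone_slowly_varying L\<^sub>1" and "quasi_monotone_slowly_varying L\<^sub>2"
    and "b\<^sub>1 > 0"
    and "(L\<^sub>1 \<longlongrightarrow> b\<^sub>1) at_top" and "((\<lambda>x. \<xi> * L\<^sub>2 x) \<longlongrightarrow> b\<^sub>2) at_top"
    and "b\<^sub>2 = 0 \<or>
      b\<^sub>2 \<noteq> 0 \<and> b\<^sub>1 / b\<^sub>2 \<in> {- tan (pi * (d - \<epsilon>))<..<tan (pi * (d - \<epsilon>))}"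
  shows "\<exists>f\<^sub>X R_minus R_plus c_minus c_plus.
    spectral_density (autocovariance M X) f\<^sub>X \<and>
    (\<forall>x\<in>{- pi..pi}. \<bar>x\<bar> \<noteq> lam\<^sub>0 \<longrightarrow>
       spectral_series_sums (autocovariance M X) x (f\<^sub>X x)) \<and>
    (\<forall>x. 0 < x \<and> x < lam\<^sub>0 \<longrightarrow>
       f\<^sub>X x = (c_minus + R_minus (lam\<^sub>0 - x)) * (lam\<^sub>0 - x) powr (- 2 * d)) \<and>
    (\<forall>x. lam\<^sub>0 < x \<and> x < pi \<longrightarrow>
       f\<^sub>X x = (c_plus + R_plus (x - lam\<^sub>0)) * (x - lam\<^sub>0) powr (- 2 * d)) \<and>
    (R_minus \<longlongrightarrow> 0) (at_right 0) \<and>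
    (R_plus \<longlongrightarrow> 0) (at_right 0) \<and>
    c_minus = 0 \<and>
    c_plus = c\<^sub>\<gamma> / (2 * pi) * Gamma (2 * d) * sin (2 * pi * d)"
proof -
  have lam: "0 < lam\<^sub>0" "lam\<^sub>0 < pi" and d: "0 < d" "d < 1 / 2" and \<epsilon>: "0 < \<epsilon>" "\<epsilon> < d"
    using assms(1,2,8) by auto
  note \<phi> = assms(4) and ss = assms(5) and \<gamma>_eq = assms(6) and R_eq = assms(7)
  define a b where "a = 2 * d" and "b = 2 * (d - \<epsilon>)"
  have a: "0 < a" "a < 1" and b: "0 < b" "b < a" "b < 1"
    using d \<epsilon> by (auto simp: a_def b_def)
  define \<gamma> where "\<gamma> = autocovariance M X"
  \<comment> \<open>The factor \<open>- \<i>\<close> produces the sine: the real part of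
    \<open>- \<i> * cis (k * lam\<^sub>0)\<close> is \<open>sin (k * lam\<^sub>0)\<close>.\<close>
  define E where "E k = of_real (L\<^sub>1 (real k) * real k powr (b - 1))
    + (- \<i> * of_real \<xi>) * of_real (L\<^sub>2 (real k) * real k powr (b - 1))" for k
  define w where "w = of_real c\<^sub>\<gamma> * cis \<phi>"
  define A where "A k = w * of_real (real k powr (a - 1)) + E k" for k
  \<comment> \<open>Because \<open>\<xi> * \<xi> = 1\<close>, a second factor \<open>\<xi>\<close>
    turns the hypothesis into a limit of \<open>L\<^sub>2\<close> itself, as
    \<open>power_decay_quasi_monotone\<close> requires.\<close>
  have "((\<lambda>x. \<xi> * (\<xi> * L\<^sub>2 x)) \<longlongrightarrow> \<xi> * b\<^sub>2) at_top"
    by (intro tendsto_intros assms(14))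
  moreover have "\<xi> * \<xi> = 1" using assms(9) by auto
  ultimately have L2: "(L\<^sub>2 \<longlongrightarrow> \<xi> * b\<^sub>2) at_top" by (simp flip: mult.assoc)
  obtain C1 where "power_decay C1 b (\<lambda>k. of_real (L\<^sub>1 (real k) * real k powr (b - 1)))"
    using power_decay_quasi_monotone[OF assms(10) assms(13) b(3)] by blast
  moreover obtain C2 where "power_decay C2 b (\<lambda>k. of_real (L\<^sub>2 (real k) * real k powr (b - 1)))"
    using power_decay_quasi_monotone[OF assms(11) L2 b(3)] by blast
  ultimately obtain CE where E: "power_decay CE b E"
    unfolding E_def[abs_def] using power_decay_add power_decay_cmult by blast
  have E0: "E 0 = 0" by (simp add: E_def)
  obtain C0 where "power_decay C0 a (\<lambda>k. of_real (real k powr (a - 1)))"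
    using power_decay_powr[OF a(2)] by blast
  then obtain C where A: "power_decay C a A"
    unfolding A_def[abs_def]
    using power_decay_add[OF power_decay_cmult power_decay_mono[OF E]] b(2) by fastforce
  have A0: "A 0 = 0" by (simp add: A_def E0)
  have \<gamma>A: "\<gamma> (int k) = Re (A k * cis (real k * lam\<^sub>0))" if k: "k \<ge> 1" for k
  proof -
    define p where "p = real k powr (a - 1)"
    have pb: "real k powr (b - 1) = real k powr (- 2 * \<epsilon>) * p"
      unfolding p_def by (simp add: a_def b_def algebra_simps flip: powr_add)
    have "\<gamma> (int k) = (c\<^sub>\<gamma> * cos (lam\<^sub>0 * real k + \<phi>) + R\<^sub>\<gamma> k) * p"
      unfolding \<gamma>_def p_def a_def by (rule \<gamma>_eq[OF k])
    also have "\<dots> = Re (A k * cis (real k * lam\<^sub>0))"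
      unfolding R_eq[OF k] A_def E_def w_def pb p_def[symmetric]
      by (simp add: cos_add algebra_simps)
    finally show ?thesis .
  qed
  define F where "F t = (\<Sum>k. A k * cis t ^ k)" for t
  define f where "f = (\<lambda>x. if \<bar>x\<bar> \<le> pi \<and> \<bar>x\<bar> \<noteq> lam\<^sub>0
    then (\<gamma> 0 + Re (F (lam\<^sub>0 + x)) + Re (F (lam\<^sub>0 - x))) / (2 * pi) else 0)"
  have \<gamma>even: "\<gamma> (- h) = \<gamma> h" for h
    unfolding \<gamma>_def by (rule autocovariance_minus[OF ss])
  have \<gamma>nn: "0 \<le> (\<Sum>n<N. \<Sum>h=- int n..int n. \<gamma> h * cos (of_int h * x))" for x N
    unfolding \<gamma>_def by (rule Fejer_sum_nonneg[OF ss])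
  note sd = spectral_density_of_power_decay[OF \<gamma>even \<gamma>nn A a A0 \<gamma>A lam,
      folded F_def, folded f_def]
  define cp where "cp = c\<^sub>\<gamma> / (2 * pi) * Gamma (2 * d) * sin (2 * pi * d)"
  \<comment> \<open>Substitute \<open>x = lam\<^sub>0 - s * y\<close>, with \<open>s = 1\<close> to
    the left of \<open>lam\<^sub>0\<close> and \<open>s = -1\<close> to the right. Then
    \<open>lam\<^sub>0 - x = s * y\<close> is the singular angle, while
    \<open>lam\<^sub>0 + x\<close> tends to \<open>2 * lam\<^sub>0\<close>, which lies strictly
    between \<open>0\<close> and \<open>2 * pi\<close>.\<close>
  have near: "((\<lambda>y. y powr a * ((\<gamma> 0 + Re (F (2 * lam\<^sub>0 - s * y)) + Re (F (s * y))) / (2 * pi)))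
      \<longlongrightarrow> c\<^sub>\<gamma> / (2 * pi) * Gamma a * cos (\<phi> + s * (a * pi / 2))) (at_right 0)"
    if s: "s = 1 \<or> s = -1" for s
  proof -
    have "((\<lambda>y. 2 * lam\<^sub>0 - s * y) \<longlongrightarrow> 2 * lam\<^sub>0 - s * 0) (at_right 0)"
      by (intro tendsto_intros)
    then have far: "((\<lambda>y. of_real (y powr a) * F (2 * lam\<^sub>0 - s * y)) \<longlongrightarrow> 0) (at_right 0)"
      unfolding F_def
      by (intro power_decay_series_bounded_away[OF A a A0, of _ "2 * lam\<^sub>0"]) (use lam in auto)
    have close: "((\<lambda>y. of_real (y powr a) * F (s * y)) \<longlongrightarrow>
        w * (of_real (Gamma a) * cis (s * (a * pi / 2)))) (at_right 0)"
      unfolding F_def A_def by (rule perturbed_powr_series_asymp[OF E b(1,2) a(2) E0 s])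
    have "((\<lambda>y. (y powr a * \<gamma> 0 + Re (of_real (y powr a) * F (2 * lam\<^sub>0 - s * y))
        + Re (of_real (y powr a) * F (s * y))) / (2 * pi)) \<longlongrightarrow>
        (0 * \<gamma> 0 + Re 0 + Re (w * (of_real (Gamma a) * cis (s * (a * pi / 2))))) / (2 * pi)) (at_right 0)"
      by (intro tendsto_intros far close tendsto_powr_at_right_0 a) simp
    also have "(\<lambda>y. (y powr a * \<gamma> 0 + Re (of_real (y powr a) * F (2 * lam\<^sub>0 - s * y))
        + Re (of_real (y powr a) * F (s * y))) / (2 * pi))
        = (\<lambda>y. y powr a * ((\<gamma> 0 + Re (F (2 * lam\<^sub>0 - s * y)) + Re (F (s * y))) / (2 * pi)))"
      by (auto simp: field_simps)
    also have "(0 * \<gamma> 0 + Re 0 + Re (w * (of_real (Gamma a) * cis (s * (a * pi / 2))))) / (2 * pi)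
        = c\<^sub>\<gamma> / (2 * pi) * Gamma a * cos (\<phi> + s * (a * pi / 2))"
      unfolding cos_add by (simp add: w_def field_simps)
    finally show ?thesis .
  qed
  have evs: "\<forall>\<^sub>F y in at_right 0. 0 < y \<and> y < lam\<^sub>0 \<and> y < pi - lam\<^sub>0"
    unfolding eventually_at_right_field
    by (intro exI[of _ "min lam\<^sub>0 (pi - lam\<^sub>0)"]) (use lam in auto)
  have minus: "((\<lambda>y. y powr a * f (lam\<^sub>0 - y)) \<longlongrightarrow> 0) (at_right 0)"
  proof (rule Lim_transform_eventually)
    \<comment> \<open>The phase \<open>\<phi> = pi / 2 - pi * d\<close> of the covariance and the
      phase \<open>a * pi / 2 = pi * d\<close> of the singularity add up to a right angle, so the
      leading coefficient vanishes.\<close>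
    have "\<phi> + 1 * (a * pi / 2) = pi / 2" by (simp add: \<phi> a_def field_simps)
    then have "cos (\<phi> + 1 * (a * pi / 2)) = 0" by (simp only: cos_pi_half)
    then show "((\<lambda>y. y powr a * ((\<gamma> 0 + Re (F (2 * lam\<^sub>0 - 1 * y)) + Re (F (1 * y))) / (2 * pi)))
        \<longlongrightarrow> 0) (at_right 0)"
      using near[OF disjI1[OF refl]] by (simp only: mult_zero_right)
    show "\<forall>\<^sub>F y in at_right 0. y powr a * ((\<gamma> 0 + Re (F (2 * lam\<^sub>0 - 1 * y)) + Re (F (1 * y))) / (2 * pi))
        = y powr a * f (lam\<^sub>0 - y)"
      using evs
    proof eventually_elim
      case (elim y)
      then have "\<bar>lam\<^sub>0 - y\<bar> \<le> pi" "\<bar>lam\<^sub>0 - y\<bar> \<noteq> lam\<^sub>0" using lam by auto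
      then show ?case by (simp add: f_def algebra_simps)
    qed
  qed
  have plus: "((\<lambda>y. y powr a * f (lam\<^sub>0 + y)) \<longlongrightarrow> cp) (at_right 0)"
  proof (rule Lim_transform_eventually)
    \<comment> \<open>On the right the phases are subtracted, and
      \<open>cos (pi / 2 - 2 * pi * d) = sin (2 * pi * d)\<close> supplies the constant.\<close>
    have "\<phi> + (- 1) * (a * pi / 2) = pi / 2 - 2 * pi * d" by (simp add: \<phi> a_def field_simps)
    then have "cos (\<phi> + (- 1) * (a * pi / 2)) = cos (pi / 2 - 2 * pi * d)"
      by (rule arg_cong)
    also have "\<dots> = sin (2 * pi * d)"
      by (simp add: cos_diff)
    finally show "((\<lambda>y. y powr a * ((\<gamma> 0 + Re (F (2 * lam\<^sub>0 - (- 1) * y)) + Re (F ((- 1) * y))) / (2 * pi)))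
        \<longlongrightarrow> cp) (at_right 0)"
      using near[of "- 1"] unfolding cp_def a_def by simp
    show "\<forall>\<^sub>F y in at_right 0. y powr a * ((\<gamma> 0 + Re (F (2 * lam\<^sub>0 - (- 1) * y)) + Re (F ((- 1) * y))) / (2 * pi))
        = y powr a * f (lam\<^sub>0 + y)"
      using evs
    proof eventually_elim
      case (elim y)
      then have "\<bar>lam\<^sub>0 + y\<bar> \<le> pi" "\<bar>lam\<^sub>0 + y\<bar> \<noteq> lam\<^sub>0" using lam by auto
      then show ?case by (simp add: f_def algebra_simps)
    qed
  qed
  \<comment> \<open>The remainders are obtained by solving the desired representations for them, so
    these hold exactly on the whole intervals and \<open>minus\<close> and \<open>plus\<close>
    supply the limits.\<close>
  define R_minus where "R_minus y = y powr a * f (lam\<^sub>0 - y)" for y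
  define R_plus where "R_plus y = y powr a * f (lam\<^sub>0 + y) - cp" for y
  have cancel: "x = y powr a * x * y powr (- 2 * d)" if "0 < y" for x y :: real
    using that by (simp add: a_def powr_minus)
  show ?thesis
  proof (intro exI conjI)
    show "spectral_density (autocovariance M X) f"
      using sd(1) by (simp add: \<gamma>_def)
    show "\<forall>x\<in>{- pi..pi}. \<bar>x\<bar> \<noteq> lam\<^sub>0 \<longrightarrow> spectral_series_sums (autocovariance M X) x (f x)"
      using sd(2) unfolding \<gamma>_def f_def by auto
    show "\<forall>x. 0 < x \<and> x < lam\<^sub>0 \<longrightarrow> f x = (0 + R_minus (lam\<^sub>0 - x)) * (lam\<^sub>0 - x) powr (- 2 * d)"
      using cancel by (auto simp: R_minus_def)
    show "\<forall>x. lam\<^sub>0 < x \<and> x < pi \<longrightarrow> f x = (cp + R_plus (x - lam\<^sub>0)) * (x - lam\<^sub>0) powr (- 2 * d)"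
      using cancel by (auto simp: R_plus_def)
    show "(R_minus \<longlongrightarrow> 0) (at_right 0)"
      unfolding R_minus_def by (rule minus)
    show "(R_plus \<longlongrightarrow> 0) (at_right 0)"
      unfolding R_plus_def using tendsto_diff[OF plus tendsto_const[of cp]] by simp
    show "cp = c\<^sub>\<gamma> / (2 * pi) * Gamma (2 * d) * sin (2 * pi * d)"
      by (rule cp_def)
  qed simp
qed

end
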